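(* For every $d\geq 3$, the form $$G_d=\sum_{i=0}^{d-1}v_iu_0^iu_1^{d-1-i}$$ of degree $d$ in the $d+2$ variables $v_0,\dots,v_{d-1},u_0,u_1$ over $\mathbb C$ is wild.
   Context: Let $V^*$ be a complex vector space of dimension $n+1$ (here $V^*=\langle v_0,\dots,v_{d-1},u_0,u_1\rangle$, $n=d+1$) and $F\in S^dV^*$ a nonzero form. Let $X=\nu_d(\mathbb P^n)\subset\mathbb P(S^dV^* )$ be the Veronese variety of $d$-th powers $[L^d]$, $L\in V^*$. The border rank $\underline{\mathbf r}(F)$ is the least $r$ with $[F]\in\sigma_r(X)$, the $r$-th secant variety of $X$ (closure of the union of spans of $r$ points of $X$). The smoothable rank $\mathrm{sr}(F)$ is the least $r$ such that there is a zero-dimensional scheme $R\subset X$ of length $r$, smoothable in $X$ (a flat limit of reduced schemes of $r$ distinct points of $X$), with $[F]$ in the linear span of $R$. $F$ is wild if $\mathrm{sr}(F)>\underline{\mathbf r}(F)$. *)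

theory Defs
  imports Complex_Main "HOL-Library.Poly_Mapping" "HOL-Library.Extended_Nat"
begin

section \<open>Polynomials and forms\<close>

text \<open>
  A polynomial with variables indexed by \<^typ>\<open>'x\<close> and coefficients in \<^typ>\<open>'a\<close> is a finitely
  supported map from exponent vectors to coefficients.  The variables that may occur are
  restricted by an explicit set \<open>B\<close>.
\<close>

type_synonym ('x, 'a) mpoly = "('x \<Rightarrow>\<^sub>0 nat) \<Rightarrow>\<^sub>0 'a"

definition Var :: "'x \<Rightarrow> ('x, 'a::comm_ring_1) mpoly" where
  "Var x = Poly_Mapping.single (Poly_Mapping.single x 1) 1"

definition mdeg :: "('x \<Rightarrow>\<^sub>0 nat) \<Rightarrow> nat" where
  "mdeg m = (\<Sum>x\<in>Poly_Mapping.keys m. Poly_Mapping.lookup m x)"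

definition monomials :: "'x set \<Rightarrow> nat \<Rightarrow> ('x \<Rightarrow>\<^sub>0 nat) set" where
  "monomials B k = {m. Poly_Mapping.keys m \<subseteq> B \<and> mdeg m = k}"

definition polys :: "'x set \<Rightarrow> ('x, 'a::comm_ring_1) mpoly set" where
  "polys B = {f. \<forall>m\<in>Poly_Mapping.keys f. Poly_Mapping.keys m \<subseteq> B}"

definition forms :: "'x set \<Rightarrow> nat \<Rightarrow> ('x, 'a::comm_ring_1) mpoly set" where
  "forms B k = {f. Poly_Mapping.keys f \<subseteq> monomials B k}"

definition hcomp :: "nat \<Rightarrow> ('x, 'a::comm_ring_1) mpoly \<Rightarrow> ('x, 'a) mpoly" where
  "hcomp k f = (\<Sum>m | m \<in> Poly_Mapping.keys f \<and> mdeg m = k.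
     Poly_Mapping.single m (Poly_Mapping.lookup f m))"

definition ev :: "('x \<Rightarrow>\<^sub>0 'a) \<Rightarrow> ('x, 'a::comm_ring_1) mpoly \<Rightarrow> 'a" where
  "ev p f = (\<Sum>m\<in>Poly_Mapping.keys f.
     Poly_Mapping.lookup f m * (\<Prod>x\<in>Poly_Mapping.keys m. Poly_Mapping.lookup p x ^ Poly_Mapping.lookup m x))"

definition scale :: "complex \<Rightarrow> ('x \<Rightarrow>\<^sub>0 complex) \<Rightarrow> ('x \<Rightarrow>\<^sub>0 complex)" where
  "scale c p = Poly_Mapping.map ((*) c) p"

lemma lookup_scale [simp]: "Poly_Mapping.lookup (scale c p) x = c * Poly_Mapping.lookup p x"
  by (simp add: scale_def Poly_Mapping.map.rep_eq when_def)

interpretation pm: vector_space scale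
  by standard (auto intro!: poly_mapping_eqI simp: lookup_add algebra_simps)


section \<open>Projective varieties and closed subschemes of projective space\<close>

text \<open>
  For a finite set \<open>B\<close>, projective space \<open>\<P>(\<complex>\<^sup>B)\<close> is represented by the nonzero vectors
  \<open>p\<close> with \<open>Poly_Mapping.keys p \<subseteq> B\<close>; a vector and its nonzero multiples represent the same point.
  A subset of projective space is given by a set of representatives.
\<close>

definition proj_space :: "'x set \<Rightarrow> ('x \<Rightarrow>\<^sub>0 complex) set" where
  "proj_space B = {p. Poly_Mapping.keys p \<subseteq> B \<and> p \<noteq> 0}"

definition zariski_closure :: "'x set \<Rightarrow> ('x \<Rightarrow>\<^sub>0 complex) set \<Rightarrow> ('x \<Rightarrow>\<^sub>0 complex) set" where
  "zariski_closure B A = {q \<in> proj_space B.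
     \<forall>k. \<forall>f\<in>forms B k. (\<forall>p\<in>A. ev p f = 0) \<longrightarrow> ev q f = 0}"

definition hom_ideal :: "'x set \<Rightarrow> ('x, 'a::comm_ring_1) mpoly set \<Rightarrow> bool" where
  "hom_ideal B I \<longleftrightarrow> I \<subseteq> polys B \<and> 0 \<in> I \<and> (\<forall>f\<in>I. \<forall>g\<in>I. f + g \<in> I) \<and>
     (\<forall>f\<in>I. \<forall>g\<in>polys B. g * f \<in> I) \<and> (\<forall>f\<in>I. \<forall>k. hcomp k f \<in> I)"

text \<open>Saturation with respect to the irrelevant ideal, which is generated by \<open>forms B 1\<close>.\<close>

definition saturation :: "'x set \<Rightarrow> ('x, complex) mpoly set \<Rightarrow> ('x, complex) mpoly set" where
  "saturation B I = {f \<in> polys B. \<exists>k. \<forall>g\<in>forms B k. g * f \<in> I}"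

definition vanishing_ideal :: "'x set \<Rightarrow> ('x \<Rightarrow>\<^sub>0 complex) set \<Rightarrow> ('x, complex) mpoly set" where
  "vanishing_ideal B A = {f \<in> polys B. \<forall>k. \<forall>p\<in>A. ev p (hcomp k f) = 0}"

definition hilbert_function :: "'x set \<Rightarrow> ('x, complex) mpoly set \<Rightarrow> nat \<Rightarrow> nat" where
  "hilbert_function B I k = pm.dim (forms B k) - pm.dim (I \<inter> forms B k)"

text \<open>
  The subscheme of \<open>\<P>(\<complex>\<^sup>B)\<close> defined by a homogeneous ideal \<open>I\<close> is zero-dimensional of length \<open>r\<close>
  (empty if \<open>r = 0\<close>) iff the Hilbert polynomial of \<open>I\<close> is the constant \<open>r\<close>.
\<close>

definition has_length :: "'x set \<Rightarrow> ('x, complex) mpoly set \<Rightarrow> nat \<Rightarrow> bool" where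
  "has_length B I r \<longleftrightarrow> (\<exists>k0. \<forall>k\<ge>k0. hilbert_function B I k = r)"

text \<open>Closed subschemes of projective space correspond to saturated homogeneous ideals.\<close>

definition zero_dim_scheme :: "'x set \<Rightarrow> ('x, complex) mpoly set \<Rightarrow> nat \<Rightarrow> bool" where
  "zero_dim_scheme B I r \<longleftrightarrow> hom_ideal B I \<and> saturation B I = I \<and> has_length B I r"

definition contained_in ::
    "'x set \<Rightarrow> ('x, complex) mpoly set \<Rightarrow> ('x \<Rightarrow>\<^sub>0 complex) set \<Rightarrow> bool" where
  "contained_in B I X \<longleftrightarrow> vanishing_ideal B X \<subseteq> I"

definition linear_span :: "'x set \<Rightarrow> ('x, complex) mpoly set \<Rightarrow> ('x \<Rightarrow>\<^sub>0 complex) set" where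
  "linear_span B I = {q \<in> proj_space B. \<forall>l \<in> I \<inter> forms B 1. ev q l = 0}"


section \<open>Smoothability\<close>

definition irreducible_affine_variety :: "nat \<Rightarrow> (nat \<Rightarrow>\<^sub>0 complex) set \<Rightarrow> bool" where
  "irreducible_affine_variety m T \<longleftrightarrow>
     (\<exists>E \<subseteq> polys {..<m}. T = {b. Poly_Mapping.keys b \<subseteq> {..<m} \<and> (\<forall>e\<in>E. ev b e = 0)}) \<and> T \<noteq> {} \<and>
     (\<forall>f\<in>polys {..<m}. \<forall>g\<in>polys {..<m}.
        (\<forall>b\<in>T. ev b (f * g) = 0) \<longrightarrow> (\<forall>b\<in>T. ev b f = 0) \<or> (\<forall>b\<in>T. ev b g = 0))"

text \<open>
  A homogeneous ideal \<open>J\<close> of polynomials in the coordinates of \<open>\<complex>\<^sup>B\<close>, with coefficients that are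
  polynomials on the parameter space, defines a closed subscheme of \<open>\<P>(\<complex>\<^sup>B) \<times> T\<close>; its fibre over
  \<open>b \<in> T\<close> is obtained by evaluating all coefficients at \<open>b\<close>.
\<close>

definition fibre ::
    "(nat \<Rightarrow>\<^sub>0 complex) \<Rightarrow> ('x, (nat, complex) mpoly) mpoly set \<Rightarrow> ('x, complex) mpoly set" where
  "fibre b J = Poly_Mapping.map (ev b) ` J"

text \<open>
  The parameter variety \<open>T\<close> is integral, so flatness over \<open>T\<close> of the projective family
  defined by \<open>J\<close> means that all fibres have the same Hilbert polynomial (here the constant \<open>r\<close>).
\<close>

definition flat_family ::
    "'x set \<Rightarrow> (nat \<Rightarrow>\<^sub>0 complex) set \<Rightarrow> ('x, (nat, complex) mpoly) mpoly set \<Rightarrow> nat \<Rightarrow> bool" where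
  "flat_family B T J r \<longleftrightarrow> hom_ideal B J \<and> (\<forall>b\<in>T. has_length B (fibre b J) r)"

definition distinct_points :: "('x \<Rightarrow>\<^sub>0 complex) set \<Rightarrow> nat \<Rightarrow> bool" where
  "distinct_points P r \<longleftrightarrow> finite P \<and> card P = r \<and>
     (\<forall>p\<in>P. \<forall>q\<in>P. p \<noteq> q \<longrightarrow> (\<forall>c. q \<noteq> scale c p))"

text \<open>
  The scheme with saturated ideal \<open>I\<close> is a special fibre of a flat family over an irreducible
  base whose fibres over a nonempty open set are reduced schemes of \<open>r\<close> distinct points of \<open>X\<close>.
\<close>

definition smoothable_in ::
    "'x set \<Rightarrow> ('x \<Rightarrow>\<^sub>0 complex) set \<Rightarrow> ('x, complex) mpoly set \<Rightarrow> nat \<Rightarrow> bool" where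
  "smoothable_in B X I r \<longleftrightarrow>
     (\<exists>m T J b0 h. irreducible_affine_variety m T \<and> flat_family B T J r \<and>
        b0 \<in> T \<and> saturation B (fibre b0 J) = I \<and>
        h \<in> polys {..<m} \<and> (\<exists>b\<in>T. ev b h \<noteq> 0) \<and>
        (\<forall>b\<in>T. ev b h \<noteq> 0 \<longrightarrow>
           (\<exists>P \<subseteq> X. distinct_points P r \<and> saturation B (fibre b J) = vanishing_ideal B P)))"


section \<open>Border rank, smoothable rank and wild forms\<close>

text \<open>
  \<open>V\<^sup>*\<close> has basis \<open>Var 0, \<dots>, Var n\<close>, so \<open>forms {..n} d\<close> is \<open>S\<^sup>d V\<^sup>*\<close>.  Its basis is
  \<open>monomials {..n} d\<close>, and a form \<^emph>\<open>is\<close> its vector of coefficients: the projective space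
  \<open>\<P>(S\<^sup>d V\<^sup>*)\<close> is \<open>proj_space (monomials {..n} d)\<close>, and its coordinate ring is
  \<open>polys (monomials {..n} d)\<close>, a polynomial ring in variables indexed by monomials.
  As \<open>\<complex>\<close> has \<open>d\<close>-th roots, for \<open>d > 0\<close> the set \<open>veronese n d\<close> contains all
  representatives of its points.
\<close>

definition veronese :: "nat \<Rightarrow> nat \<Rightarrow> (nat, complex) mpoly set" where
  "veronese n d = {L ^ d | L. L \<in> forms {..n} 1 \<and> L \<noteq> 0}"

definition secant_variety ::
    "'x set \<Rightarrow> ('x \<Rightarrow>\<^sub>0 complex) set \<Rightarrow> nat \<Rightarrow> ('x \<Rightarrow>\<^sub>0 complex) set" where
  "secant_variety B X r = zariski_closure B
     (\<Union>x \<in> {x. \<forall>i<r. x i \<in> X}. pm.span (x ` {..<r}) - {0})"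

text \<open>In both ranks the infimum in \<^typ>\<open>enat\<close> is the least \<open>r\<close>, if one exists.\<close>

definition border_rank :: "nat \<Rightarrow> nat \<Rightarrow> (nat, complex) mpoly \<Rightarrow> enat" where
  "border_rank n d F =
     Inf {enat r | r. F \<in> secant_variety (monomials {..n} d) (veronese n d) r}"

definition smoothable_rank :: "nat \<Rightarrow> nat \<Rightarrow> (nat, complex) mpoly \<Rightarrow> enat" where
  "smoothable_rank n d F = Inf {enat r | r. \<exists>R.
     zero_dim_scheme (monomials {..n} d) R r \<and>
     contained_in (monomials {..n} d) R (veronese n d) \<and>
     smoothable_in (monomials {..n} d) (veronese n d) R r \<and>
     F \<in> linear_span (monomials {..n} d) R}"

definition wild :: "nat \<Rightarrow> nat \<Rightarrow> (nat, complex) mpoly \<Rightarrow> bool" where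
  "wild n d F \<longleftrightarrow> F \<in> forms {..n} d \<and> F \<noteq> 0 \<and> smoothable_rank n d F > border_rank n d F"

text \<open>The variables \<open>v\<^sub>0, \<dots>, v\<^bsub>d-1\<^esub>, u\<^sub>0, u\<^sub>1\<close> are numbered \<open>0, \<dots>, d - 1, d, d + 1\<close>.\<close>

definition G :: "nat \<Rightarrow> (nat, complex) mpoly" where
  "G d = (\<Sum>i<d. Var i * Var d ^ i * Var (d + 1) ^ (d - 1 - i))"

end

theory Submission
  imports Defs "HOL-Library.Function_Algebras"
begin

text \<open>
  Let \<open>S\<close> be the coordinate ring of \<open>\<P>\<^sup>n\<close>, \<open>n = d + 1\<close>, and let a scheme of length \<open>r \<le> d + 2\<close> in the
  Veronese variety span \<open>G\<^sub>d\<close>.  Its saturated ideal \<open>I\<close> in \<open>S\<close> is apolar to \<open>G\<^sub>d\<close>.  The Hilbert function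
  of \<open>S/I\<close> is nondecreasing, because a generic linear form is not a zero divisor, so it is at most
  \<open>d + 2\<close> in degree 2.  But already \<open>S\<^sub>2\<close> modulo the quadrics apolar to \<open>G\<^sub>d\<close> has dimension \<open>d + 2\<close>, so all
  these quadrics lie in \<open>I\<close>.  Writing \<open>\<alpha>\<^sub>i, \<beta>, \<beta>'\<close> for the coordinates dual to \<open>v\<^sub>i, u\<^sub>0, u\<^sub>1\<close>, they
  include \<open>\<alpha>\<^sub>i \<alpha>\<^sub>j\<close>, \<open>\<alpha>\<^sub>0 \<beta>\<close>, \<open>\<alpha>\<^bsub>d-1\<^esub> \<beta>'\<close> and, for suitable constants \<open>c\<close>, \<open>\<alpha>\<^sub>i \<beta>' - c \<alpha>\<^bsub>i+1\<^esub> \<beta>\<close>.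
  Hence \<open>\<alpha>\<^sub>0\<close> is annihilated modulo \<open>I\<close> by a power of every coordinate, so \<open>\<alpha>\<^sub>0 \<in> I\<close> by saturation,
  although \<open>G\<^sub>d\<close> depends on \<open>v\<^sub>0\<close>.

  For the border rank, \<open>G\<^sub>d\<close> is, up to a constant and a change of the \<open>v\<^sub>i\<close>, a sum of terms \<open>w\<^sub>j L\<^sub>j\<^bsup>d-1\<^esup>\<close> with
  linear forms \<open>L\<^sub>j\<close> in \<open>u\<^sub>0, u\<^sub>1\<close> and thus a derivative of \<open>\<Sum>\<^sub>j c\<^sub>j (L\<^sub>j + \<epsilon> w\<^sub>j)\<^sup>d\<close> at \<open>\<epsilon> = 0\<close>, where the
  \<open>c\<^sub>j\<close> form a linear relation among the \<open>d\<close>-th powers of \<open>d + 2\<close> forms \<open>L\<^sub>j\<close>.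
\<close>

section \<open>Monomials, forms and evaluation\<close>

lemma poly_mapping_sum_single:
  "f = (\<Sum>m\<in>Poly_Mapping.keys f. Poly_Mapping.single m (Poly_Mapping.lookup f m))"
proof (rule poly_mapping_eqI)
  fix k
  show "Poly_Mapping.lookup f k = Poly_Mapping.lookup
      (\<Sum>m\<in>Poly_Mapping.keys f. Poly_Mapping.single m (Poly_Mapping.lookup f m)) k"
    by (auto simp: lookup_sum lookup_single when_def in_keys_iff)
qed

lemma mdeg_superset:
  assumes "finite S" "Poly_Mapping.keys m \<subseteq> S"
  shows "mdeg m = (\<Sum>x\<in>S. Poly_Mapping.lookup m x)"
  unfolding mdeg_def by (rule sum.mono_neutral_left) (use assms in \<open>auto simp: in_keys_iff\<close>)

lemma mdeg_add: "mdeg (m + m') = mdeg m + mdeg m'"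
proof -
  let ?S = "Poly_Mapping.keys m \<union> Poly_Mapping.keys m'"
  have "mdeg (m + m') = (\<Sum>x\<in>?S. Poly_Mapping.lookup (m + m') x)"
    by (rule mdeg_superset) (auto dest: subsetD[OF keys_add])
  also have "\<dots> = (\<Sum>x\<in>?S. Poly_Mapping.lookup m x) + (\<Sum>x\<in>?S. Poly_Mapping.lookup m' x)"
    by (simp add: lookup_add sum.distrib)
  also have "\<dots> = mdeg m + mdeg m'"
    by (simp add: mdeg_superset[of ?S])
  finally show ?thesis .
qed

lemma mdeg_0 [simp]: "mdeg 0 = 0"
  by (simp add: mdeg_def)

lemma mdeg_single [simp]: "mdeg (Poly_Mapping.single x k) = k"
  by (simp add: mdeg_def)

lemma mdeg_eq_0_iff: "mdeg m = 0 \<longleftrightarrow> m = 0"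
  by (auto simp: mdeg_def in_keys_iff intro!: poly_mapping_eqI)

lemma keys_add_nat: "Poly_Mapping.keys (m + m') = Poly_Mapping.keys m \<union> Poly_Mapping.keys (m' :: 'x \<Rightarrow>\<^sub>0 nat)"
  by (auto simp: in_keys_iff lookup_add)

lemma monomials_add:
  "m \<in> monomials B j \<Longrightarrow> m' \<in> monomials B k \<Longrightarrow> m + m' \<in> monomials B (j + k)"
  by (auto simp: monomials_def keys_add_nat mdeg_add)

lemma monomials_0 [simp]: "monomials B 0 = {0}"
  by (auto simp: monomials_def mdeg_eq_0_iff)

lemma single_in_monomials [simp]:
  "Poly_Mapping.single x k \<in> monomials B j \<longleftrightarrow> k = j \<and> (x \<in> B \<or> k = 0)"
  by (auto simp: monomials_def)

lemma nat_poly_mapping_diff_single: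
  assumes "x \<in> Poly_Mapping.keys (m :: 'x \<Rightarrow>\<^sub>0 nat)"
  shows "m = Poly_Mapping.single x 1 + (m - Poly_Mapping.single x 1)"
  using assms
  by (intro poly_mapping_eqI) (auto simp: lookup_add lookup_minus lookup_single when_def in_keys_iff)

lemma monomials_SucE:
  assumes "m \<in> monomials B (Suc k)"
  obtains x m' where "x \<in> B" "m' \<in> monomials B k" "m = Poly_Mapping.single x 1 + m'"
proof -
  have "m \<noteq> 0" using assms by (auto simp: monomials_def)
  then obtain x where x: "x \<in> Poly_Mapping.keys m"
    by (metis ex_in_conv keys_eq_empty)
  note eq = nat_poly_mapping_diff_single[OF x]
  have "mdeg m = Suc (mdeg (m - Poly_Mapping.single x 1))"
    using arg_cong[OF eq, of mdeg] by (simp add: mdeg_add)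
  moreover have "Poly_Mapping.keys m = insert x (Poly_Mapping.keys (m - Poly_Mapping.single x 1))"
    using arg_cong[OF eq, of Poly_Mapping.keys] by (simp add: keys_add_nat)
  ultimately show ?thesis
    using that[OF _ _ eq] assms x by (auto simp: monomials_def)
qed

lemma monomials_addE:
  assumes "m \<in> monomials B (j + k)"
  obtains m1 m2 where "m1 \<in> monomials B j" "m2 \<in> monomials B k" "m = m1 + m2"
  using assms
proof (induction j arbitrary: m thesis)
  case 0
  then show ?case by (metis add_0 monomials_0 singletonI)
next
  case (Suc j)
  from Suc.prems(2) obtain x m' where "x \<in> B" "m' \<in> monomials B (j + k)"
      "m = Poly_Mapping.single x 1 + m'"
    by (auto elim: monomials_SucE)
  moreover obtain m1 m2 where "m1 \<in> monomials B j" "m2 \<in> monomials B k" "m' = m1 + m2"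
    using Suc.IH \<open>m' \<in> monomials B (j + k)\<close> by metis
  moreover have "Poly_Mapping.single x 1 + m1 \<in> monomials B (1 + j)"
    using \<open>x \<in> B\<close> \<open>m1 \<in> _\<close> by (intro monomials_add) auto
  ultimately show ?case
    using Suc.prems(1)[of "Poly_Mapping.single x 1 + m1" m2] by (simp add: add.assoc)
qed

lemma finite_monomials: "finite B \<Longrightarrow> finite (monomials B k)"
proof (induction k)
  case (Suc k)
  have "monomials B (Suc k) \<subseteq> (\<lambda>(x, m). Poly_Mapping.single x 1 + m) ` (B \<times> monomials B k)"
    by (auto elim!: monomials_SucE)
  then show ?case
    using Suc by (meson finite_SigmaI finite_imageI finite_subset)
qed simp

section \<open>Forms of a given degree\<close>

lemma forms_iff: "f \<in> forms B k \<longleftrightarrow> (\<forall>m. m \<notin> monomials B k \<longrightarrow> Poly_Mapping.lookup f m = 0)"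
  by (auto simp: forms_def in_keys_iff)

lemma forms_subset_polys: "forms B k \<subseteq> polys B"
  by (force simp: forms_def polys_def monomials_def)

lemma subspace_forms: "pm.subspace (forms B k)"
  by (auto simp: pm.subspace_def forms_iff lookup_add)

lemma forms_mult: "f \<in> forms B j \<Longrightarrow> g \<in> forms B k \<Longrightarrow> f * g \<in> forms B (j + k)"
  by (force simp: forms_def intro: monomials_add dest!: subsetD[OF keys_mult])

lemma single_in_forms: "m \<in> monomials B k \<Longrightarrow> Poly_Mapping.single m c \<in> forms B k"
  by (simp add: forms_def)

lemma scale_eq_mult: "scale c f = Poly_Mapping.single 0 c * f"
  for f :: "('x, complex) mpoly"
  unfolding scale_def by (rule mult_map_scale_conv_mult)

lemma hcomp_form:
  assumes "f \<in> forms B k"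
  shows "hcomp j f = (if j = k then f else 0)"
proof -
  have "{m. m \<in> Poly_Mapping.keys f \<and> mdeg m = j} = (if j = k then Poly_Mapping.keys f else {})"
    using assms by (auto simp: forms_def monomials_def)
  then show ?thesis
    using poly_mapping_sum_single[of f] by (auto simp: hcomp_def)
qed

section \<open>Evaluation as a ring homomorphism\<close>

definition mon :: "('x \<Rightarrow>\<^sub>0 'a) \<Rightarrow> ('x \<Rightarrow>\<^sub>0 nat) \<Rightarrow> 'a::comm_ring_1" where
  "mon p m = (\<Prod>x\<in>Poly_Mapping.keys m. Poly_Mapping.lookup p x ^ Poly_Mapping.lookup m x)"

lemma mon_superset:
  assumes "finite S" "Poly_Mapping.keys m \<subseteq> S"
  shows "mon p m = (\<Prod>x\<in>S. Poly_Mapping.lookup p x ^ Poly_Mapping.lookup m x)"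
  unfolding mon_def by (rule prod.mono_neutral_left) (use assms in \<open>auto simp: in_keys_iff\<close>)

lemma mon_0 [simp]: "mon p 0 = 1"
  by (simp add: mon_def)

lemma mon_single [simp]: "mon p (Poly_Mapping.single x k) = Poly_Mapping.lookup p x ^ k"
  by (simp add: mon_def)

lemma mon_add: "mon p (m + m') = mon p m * mon p m'"
  by (simp add: mon_superset[of "Poly_Mapping.keys m \<union> Poly_Mapping.keys m'"]
      keys_add_nat lookup_add power_add prod.distrib)

lemma ev_superset:
  assumes "finite S" "Poly_Mapping.keys f \<subseteq> S"
  shows "ev p f = (\<Sum>m\<in>S. Poly_Mapping.lookup f m * mon p m)"
  unfolding ev_def mon_def
  by (rule sum.mono_neutral_left) (use assms in \<open>auto simp: in_keys_iff\<close>)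

lemma ev_0 [simp]: "ev p 0 = 0"
  by (simp add: ev_def)

lemma ev_single [simp]: "ev p (Poly_Mapping.single m c) = c * mon p m"
  by (simp add: ev_def mon_def)

lemma ev_add: "ev p (f + g) = ev p f + ev p g"
proof -
  let ?S = "Poly_Mapping.keys f \<union> Poly_Mapping.keys g"
  have "ev p (f + g) = (\<Sum>m\<in>?S. Poly_Mapping.lookup (f + g) m * mon p m)"
    by (rule ev_superset) (auto dest: subsetD[OF keys_add])
  then show ?thesis
    by (simp add: ev_superset[of ?S] lookup_add distrib_right sum.distrib)
qed

lemma ev_sum: "ev p (\<Sum>i\<in>S. f i) = (\<Sum>i\<in>S. ev p (f i))"
  by (induction S rule: infinite_finite_induct) (auto simp: ev_add)

lemma ev_mult: "ev p (f * g) = ev p f * ev p g"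
proof -
  have "ev p (f * g) = ev p ((\<Sum>m\<in>Poly_Mapping.keys f. Poly_Mapping.single m (Poly_Mapping.lookup f m))
      * (\<Sum>m\<in>Poly_Mapping.keys g. Poly_Mapping.single m (Poly_Mapping.lookup g m)))"
    by (simp flip: poly_mapping_sum_single)
  also have "\<dots> = ev p f * ev p g"
    unfolding sum_product ev_sum mult_single ev_single mon_add
    by (simp add: ev_superset[OF finite_keys subset_refl] sum_product algebra_simps)
  finally show ?thesis .
qed

lemma ev_scale: "ev p (scale c f) = c * ev p f"
  by (simp add: scale_eq_mult ev_mult)


section \<open>Powers of linear forms\<close>

definition lin :: "nat \<Rightarrow> (nat \<Rightarrow> complex) \<Rightarrow> (nat, complex) mpoly" where
  "lin n a = (\<Sum>i\<le>n. Poly_Mapping.single (Poly_Mapping.single i 1) (a i))"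

text \<open>The coordinates on projective \<open>n\<close>-space are the coefficients
  \<open>a\<close> of a linear form, so monomials are kept as functions of \<open>a\<close>.\<close>

definition monof :: "nat \<Rightarrow> (nat \<Rightarrow>\<^sub>0 nat) \<Rightarrow> (nat \<Rightarrow> complex) \<Rightarrow> complex" where
  "monof n m = (\<lambda>a. \<Prod>i\<le>n. a i ^ Poly_Mapping.lookup m i)"

definition multinomial :: "nat \<Rightarrow> (nat \<Rightarrow>\<^sub>0 nat) \<Rightarrow> complex" where
  "multinomial n m = fact (mdeg m) / (\<Prod>i\<le>n. fact (Poly_Mapping.lookup m i))"

lemma multinomial_nonzero [simp]: "multinomial n m \<noteq> 0"
  by (simp add: multinomial_def)

lemma monof_0 [simp]: "monof n 0 = 1"
  by (simp add: monof_def one_fun_def)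

lemma monof_add: "monof n (m + m') = monof n m * monof n m'"
  by (simp add: monof_def lookup_add power_add prod.distrib fun_eq_iff)

lemma monof_single: "i \<le> n \<Longrightarrow> monof n (Poly_Mapping.single i k) = (\<lambda>a. a i ^ k)"
  by (auto simp: monof_def lookup_single when_def if_distrib[of "\<lambda>k. _ ^ k"] prod.delta cong: if_cong)

lemma lin_in_forms: "lin n a \<in> forms {..n} 1"
  unfolding lin_def
  by (rule pm.subspace_sum[OF subspace_forms]) (auto intro!: single_in_forms)

lemma form_1_eq_lin:
  assumes "L \<in> forms {..n} 1"
  shows "L = lin n (\<lambda>i. Poly_Mapping.lookup L (Poly_Mapping.single i 1))"
proof (rule poly_mapping_eqI)
  fix m
  let ?R = "lin n (\<lambda>i. Poly_Mapping.lookup L (Poly_Mapping.single i 1))"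
  show "Poly_Mapping.lookup L m = Poly_Mapping.lookup ?R m"
  proof (cases "m \<in> monomials {..n} 1")
    case True
    then obtain x where x: "x \<le> n" "m = Poly_Mapping.single x 1"
      by (auto elim: monomials_SucE[of m "{..n}" 0])
    have *: "(Poly_Mapping.single i (Suc 0) = Poly_Mapping.single x (Suc 0)) = (i = x)" for i
      by (metis lookup_single_eq lookup_single_not_eq zero_neq_one One_nat_def)
    show ?thesis using x
      by (simp add: lin_def lookup_sum lookup_single when_def * sum.delta' cong: if_cong)
  next
    case False
    then show ?thesis
      using assms lin_in_forms[of n] by (auto simp: forms_iff)
  qed
qed

lemma lookup_single_mult:
  fixes p :: "('x, complex) mpoly"
  shows "Poly_Mapping.lookup (Poly_Mapping.single (Poly_Mapping.single x 1) c * p) m =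
    (if x \<in> Poly_Mapping.keys m then c * Poly_Mapping.lookup p (m - Poly_Mapping.single x 1) else 0)"
proof -
  have *: "(m = Poly_Mapping.single x 1 + q) \<longleftrightarrow>
      x \<in> Poly_Mapping.keys m \<and> q = m - Poly_Mapping.single x 1" for q
    using nat_poly_mapping_diff_single[of x m]
    by (auto simp: keys_add_nat)
  show ?thesis
    by (simp add: lookup_mult lookup_single when_mult * conj_commute flip: when_when One_nat_def)
qed

text \<open>Multinomial theorem. On multiplying by one more linear form, the summand of
  \<open>a i\<close> contributes the exponent of \<open>i\<close> times a factor independent of
  \<open>i\<close>, and these exponents add up to \<open>Suc k\<close>.\<close>

theorem lookup_lin_power:
  "Poly_Mapping.lookup (lin n a ^ k) m =
    (if m \<in> monomials {..n} k then multinomial n m * monof n m a else 0)"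
proof (induction k arbitrary: m)
  case 0
  show ?case by (auto simp: lookup_one when_def multinomial_def monof_def)
next
  case (Suc k)
  show ?case
  proof (cases "m \<in> monomials {..n} (Suc k)")
    case False
    have "lin n a ^ Suc k \<in> forms {..n} (Suc k)"
    proof (induction k)
      case (Suc k)
      then show ?case using forms_mult[OF lin_in_forms Suc, of a] by simp
    qed (use lin_in_forms in simp)
    then show ?thesis using False by (simp add: forms_iff)
  next
    case True
    let ?e = "\<lambda>i::nat. Poly_Mapping.single i (1::nat)"
    let ?l = "Poly_Mapping.lookup m"
    have deg: "(\<Sum>i\<le>n. ?l i) = Suc k"
      using True by (simp add: monomials_def flip: mdeg_superset)
    have step: "(if i \<in> Poly_Mapping.keys m then a i * Poly_Mapping.lookup (lin n a ^ k) (m - ?e i) else 0)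
       = of_nat (?l i) * (fact k / (\<Prod>i\<le>n. fact (?l i)) * monof n m a)" if "i \<le> n" for i
    proof (cases "i \<in> Poly_Mapping.keys m")
      case i: True
      define m' where "m' = m - ?e i"
      have m: "m = ?e i + m'"
        using nat_poly_mapping_diff_single[OF i] by (simp add: m'_def)
      have m': "m' \<in> monomials {..n} k"
        using True unfolding m by (auto simp: monomials_def keys_add_nat mdeg_add)
      have fl: "(\<Prod>j\<le>n. fact (?l j)) = of_nat (?l i) * (\<Prod>j\<le>n. fact (Poly_Mapping.lookup m' j) :: complex)"
      proof -
        have "(\<Prod>j\<le>n. fact (?l j) :: complex) =
            (\<Prod>j\<le>n. (if j = i then of_nat (?l i) else 1) * fact (Poly_Mapping.lookup m' j))"
          by (rule prod.cong) (auto simp: m lookup_add lookup_single when_def algebra_simps)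
        then show ?thesis using that by (simp add: prod.distrib prod.delta)
      qed
      have "monof n m a = a i * monof n m' a"
        using that by (simp add: m monof_add monof_single)
      moreover have "of_nat (?l i) \<noteq> (0::complex)"
        using i by (simp add: in_keys_iff)
      moreover have "m - ?e i = m'"
        by (simp add: m'_def)
      ultimately show ?thesis
        using i m' Suc.IH[of m'] by (simp only: fl if_True) (simp add: multinomial_def monomials_def)
    qed (simp add: in_keys_iff)
    have "Poly_Mapping.lookup (lin n a ^ Suc k) m =
       (\<Sum>i\<le>n. (if i \<in> Poly_Mapping.keys m then a i * Poly_Mapping.lookup (lin n a ^ k) (m - ?e i) else 0))"
      by (subst power_Suc, subst (1) lin_def)
        (simp only: sum_distrib_right lookup_sum lookup_single_mult)
    also have "\<dots> = (\<Sum>i\<le>n. of_nat (?l i)) * (fact k / (\<Prod>i\<le>n. fact (?l i)) * monof n m a)"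
      unfolding sum_distrib_right by (rule sum.cong) (simp_all only: step atMost_iff)
    also have "(\<Sum>i\<le>n. of_nat (?l i)) = (of_nat (Suc k) :: complex)"
      unfolding deg[symmetric] by simp
    finally show ?thesis
      using True by (simp add: multinomial_def monomials_def)
  qed
qed


section \<open>Homogeneous polynomial functions\<close>

lemmas ring_fun_apply = plus_fun_apply zero_fun_apply times_fun_apply one_fun_apply minus_apply uminus_apply

text \<open>As simplification rules these would eta-expand every unapplied ring operation on functions.\<close>

declare ring_fun_apply [simp del]

type_synonym cfun = "(nat \<Rightarrow> complex) \<Rightarrow> complex"

definition cst :: "complex \<Rightarrow> cfun" where
  "cst c = (\<lambda>_. c)"

abbreviation coord :: "nat \<Rightarrow> nat \<Rightarrow> cfun" where
  "coord n i \<equiv> monof n (Poly_Mapping.single i 1)"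

lemma cst_0 [simp]: "cst 0 = 0" and cst_1 [simp]: "cst 1 = 1"
  by (simp_all add: cst_def zero_fun_def one_fun_def)

lemma cst_mult: "cst (a * b) = cst a * cst b" and cst_add: "cst (a + b) = cst a + cst b"
  and cst_minus: "cst (- a) = - cst a"
  by (simp_all add: cst_def fun_eq_iff ring_fun_apply)

lemma sum_fun_apply: "(\<Sum>i\<in>S. f i) x = (\<Sum>i\<in>S. f i x)"
  by (induction S rule: infinite_finite_induct) (auto simp: ring_fun_apply)

lemma power_fun_apply: "(f ^ k) x = (f x :: complex) ^ k"
  by (induction k) (auto simp: ring_fun_apply)

lemma prod_fun_apply: "(\<Prod>i\<in>S. f i) x = (\<Prod>i\<in>S. f i x :: complex)"
  by (induction S rule: infinite_finite_induct) (auto simp: ring_fun_apply)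

text \<open>Forms as functions rather than formal polynomials: restriction to the Veronese variety
  is then a composition.\<close>

inductive hf :: "nat \<Rightarrow> nat \<Rightarrow> cfun \<Rightarrow> bool" for n j where
  monof: "m \<in> monomials {..n} j \<Longrightarrow> hf n j (cst c * monof n m)"
| zero: "hf n j 0"
| add: "hf n j f \<Longrightarrow> hf n j g \<Longrightarrow> hf n j (f + g)"

lemma hf_sum: "(\<And>i. i \<in> S \<Longrightarrow> hf n j (f i)) \<Longrightarrow> hf n j (\<Sum>i\<in>S. f i)"
  by (induction S rule: infinite_finite_induct) (auto intro: hf.intros)

lemma hf_monof: "m \<in> monomials {..n} j \<Longrightarrow> hf n j (monof n m)"
  using hf.monof[of m n j 1] by simp

lemma hf_cst: "hf n 0 (cst c)"
  using hf.monof[of 0 n 0 c] by simp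

lemma hf_mult:
  assumes "hf n j f" "hf n k g"
  shows "hf n (j + k) (f * g)"
  using assms(1)
proof induction
  case (monof m c)
  show ?case
    using assms(2)
  proof induction
    case (monof m' c')
    have "cst c * monof n m * (cst c' * monof n m') = cst (c * c') * monof n (m + m')"
      by (simp add: cst_mult monof_add algebra_simps)
    then show ?case
      using hf.monof[OF monomials_add[OF \<open>m \<in> _\<close> monof]] by simp
  qed (auto simp: distrib_left intro: hf.intros)
qed (auto simp: distrib_right intro: hf.intros)

lemma hf_cst_mult: "hf n j f \<Longrightarrow> hf n j (cst c * f)"
  using hf_mult[OF hf_cst] by force

lemma hf_coord: "i \<le> n \<Longrightarrow> hf n 1 (coord n i)"
  by (rule hf_monof) simp

lemma hf_coord_mult: "i \<le> n \<Longrightarrow> hf n j f \<Longrightarrow> hf n (Suc j) (coord n i * f)"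
  using hf_mult[OF hf_coord] by force

lemma hf_power: "hf n j f \<Longrightarrow> hf n (k * j) (f ^ k)"
proof (induction k)
  case 0
  then show ?case using hf_cst[of n 1] by simp
qed (auto intro: hf_mult)

lemma hf_prod:
  assumes "finite S" "\<And>i. i \<in> S \<Longrightarrow> hf n (j i) (f i)"
  shows "hf n (\<Sum>i\<in>S. j i) (\<Prod>i\<in>S. f i)"
  using assms
proof (induction S)
  case empty
  then show ?case using hf_cst[of n 1] by simp
qed (auto intro: hf_mult)

text \<open>Positive degree means membership in the irrelevant ideal: each monomial gives up one of
  its variables.\<close>

lemma hf_SucE:
  assumes "hf n (Suc j) f"
  obtains g where "\<And>i. i \<le> n \<Longrightarrow> hf n j (g i)" "f = (\<Sum>i\<le>n. coord n i * g i)"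
  using assms
proof (induction arbitrary: thesis)
  case (monof m c)
  obtain x m' where x: "x \<le> n" "m' \<in> monomials {..n} j" "m = Poly_Mapping.single x 1 + m'"
    using monof(1) by (auto elim: monomials_SucE)
  let ?g = "\<lambda>i. if i = x then cst c * monof n m' else 0"
  have "(\<Sum>i\<le>n. coord n i * ?g i) = coord n x * (cst c * monof n m')"
    using x by (simp add: if_distrib[of "\<lambda>y. _ * y"] cong: if_cong)
  also have "\<dots> = cst c * monof n m"
    by (simp only: x(3) monof_add mult.left_commute)
  finally show ?case
    using monof(2)[of ?g] x(2) by (simp add: hf.monof hf.zero)
next
  case zero
  then show ?case
    using zero[of "\<lambda>_. 0"] hf.zero by simp
next
  case (add f g)
  obtain f' where "\<And>i. i \<le> n \<Longrightarrow> hf n j (f' i)" "f = (\<Sum>i\<le>n. coord n i * f' i)"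
    using add.IH(1) by blast
  moreover obtain g' where "\<And>i. i \<le> n \<Longrightarrow> hf n j (g' i)" "g = (\<Sum>i\<le>n. coord n i * g' i)"
    using add.IH(2) by blast
  ultimately show ?case
    using add.prems[of "\<lambda>i. f' i + g' i"]
    by (simp add: distrib_left sum.distrib hf.add)
qed


section \<open>Saturated ideals and growth of the Hilbert function\<close>

text \<open>Gaussian elimination: the last equation is used to eliminate one unknown, which leaves
  one equation and one unknown fewer.\<close>

lemma homogeneous_system:
  fixes a :: "'x \<Rightarrow> nat \<Rightarrow> complex"
  assumes "finite X" "q < card X"
  shows "\<exists>c. (\<exists>x\<in>X. c x \<noteq> 0) \<and> (\<forall>e<q. (\<Sum>x\<in>X. c x * a x e) = 0)"
  using assms
proof (induction q arbitrary: X a)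
  case 0
  then obtain x where "x \<in> X" by fastforce
  then show ?case by (intro exI[of _ "\<lambda>_. 1"]) auto
next
  case (Suc q)
  show ?case
  proof (cases "\<forall>x\<in>X. a x q = 0")
    case True
    obtain c where "\<exists>x\<in>X. c x \<noteq> 0" "\<forall>e<q. (\<Sum>x\<in>X. c x * a x e) = 0"
      using Suc.IH[of X a] Suc.prems by auto
    with True show ?thesis
      by (intro exI[of _ c]) (auto simp: less_Suc_eq)
  next
    case False
    then obtain x0 where x0: "x0 \<in> X" "a x0 q \<noteq> 0" by blast
    define X' where "X' = X - {x0}"
    define a' where "a' x e = a x e - a x q / a x0 q * a x0 e" for x e
    have X: "X = insert x0 X'" "x0 \<notin> X'" "finite X'"
      using x0 Suc.prems by (auto simp: X'_def)
    obtain c where c: "\<exists>x\<in>X'. c x \<noteq> 0" "\<And>e. e < q \<Longrightarrow> (\<Sum>x\<in>X'. c x * a' x e) = 0"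
      using Suc.IH[of X' a'] Suc.prems X by auto
    \<comment> \<open>The value at \<open>x0\<close> is read off equation \<open>q\<close>; with it
      the original system at \<open>c'\<close> takes the same values as the reduced system at
      \<open>c\<close>.\<close>
    define c' where "c' = c(x0 := - (\<Sum>x\<in>X'. c x * a x q) / a x0 q)"
    have "(\<Sum>x\<in>X. c' x * a x e) = (\<Sum>x\<in>X'. c x * a' x e)" for e
    proof -
      have "(\<Sum>x\<in>X. c' x * a x e) = c' x0 * a x0 e + (\<Sum>x\<in>X'. c x * a x e)"
        using X by (auto simp: c'_def intro!: sum.cong)
      also have "\<dots> = (\<Sum>x\<in>X'. c x * a' x e)"
        by (simp add: c'_def a'_def algebra_simps sum_subtractf sum_distrib_left sum_divide_distrib)
      finally show ?thesis .
    qed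
    moreover have "a' x q = 0" for x
      using x0 by (simp add: a'_def)
    moreover have "\<exists>x\<in>X. c' x \<noteq> 0"
      using c(1) X by (auto simp: c'_def)
    ultimately show ?thesis
      using c(2) by (intro exI[of _ c']) (auto simp: less_Suc_eq)
  qed
qed

text \<open>A graded ideal given by its pieces, with saturation stated one degree at a time and for
  the coordinates only. \<open>I j\<close> may contain functions that are not forms of degree
  \<open>j\<close>.\<close>

locale saturated_ideal =
  fixes n :: nat and I :: "nat \<Rightarrow> cfun set"
  assumes zero_in: "0 \<in> I j"
    and add_in: "f \<in> I j \<Longrightarrow> g \<in> I j \<Longrightarrow> f + g \<in> I j"
    and mult_in: "f \<in> I j \<Longrightarrow> hf n i g \<Longrightarrow> g * f \<in> I (i + j)"
    and saturated: "(\<And>i. i \<le> n \<Longrightarrow> coord n i * f \<in> I (Suc j)) \<Longrightarrow> f \<in> I j"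
begin

lemma cst_mult_in: "f \<in> I j \<Longrightarrow> cst c * f \<in> I j"
  using mult_in[OF _ hf_cst] by force

lemma diff_in: "f \<in> I j \<Longrightarrow> g \<in> I j \<Longrightarrow> f - g \<in> I j"
  using add_in[of f j "cst (-1) * g"] cst_mult_in[of g j "-1"] by (simp add: cst_minus)

lemma sum_in: "(\<And>i. i \<in> S \<Longrightarrow> f i \<in> I j) \<Longrightarrow> (\<Sum>i\<in>S. f i) \<in> I j"
  by (induction S rule: infinite_finite_induct) (auto intro: zero_in add_in)

lemma coord_mult_in: "i \<le> n \<Longrightarrow> f \<in> I j \<Longrightarrow> coord n i * f \<in> I (Suc j)"
  using mult_in[OF _ hf_coord] by force

text \<open>
  A sequence \<open>g\<close> encodes the polynomial \<open>\<Sum>\<^sub>s g\<^sub>s t\<^sup>s\<close>, and \<open>lmul\<close> multiplies it by the generic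
  linear form \<open>x\<^sub>0 + x\<^sub>1 t + \<dots> + x\<^sub>n t\<^sup>n\<close>.
\<close>

definition lmul :: "(nat \<Rightarrow> cfun) \<Rightarrow> nat \<Rightarrow> cfun" where
  "lmul g u = (\<Sum>i\<le>n. if i \<le> u then coord n i * g (u - i) else 0)"

lemma lmul_mult: "lmul (\<lambda>s. h * g s) u = h * lmul g u"
  by (auto simp: lmul_def sum_distrib_left algebra_simps intro!: sum.cong)

text \<open>As in McCoy's theorem, a generic linear form that is a zero divisor modulo \<open>I\<close> would
  have a common annihilator of its coefficients, which saturation excludes.\<close>

lemma lmul_cancel_aux:
  assumes "q \<le> Suc n" "\<And>s. s > M \<Longrightarrow> g s = 0"
    and "\<And>u. lmul g u \<in> I (Suc j)"
    and "\<And>i s. i < q \<Longrightarrow> coord n i * g s \<in> I (Suc j)"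
  shows "g s \<in> I j"
  using assms
proof (induction "Suc n - q" arbitrary: q g j s)
  case 0
  \<comment> \<open>Here \<open>q = n + 1\<close>: every coordinate annihilates \<open>g s\<close>
    modulo \<open>I\<close>.\<close>
  show ?case by (rule saturated) (use 0 in auto)
next
  case (Suc k)
  then have q: "q \<le> n" by simp
  let ?x = "coord n q"
  \<comment> \<open>Coefficient \<open>s + q\<close> of the product with the generic linear form
    contains \<open>?x * g s\<close>. After multiplication by \<open>?x ^ s\<close> its other terms
    lie in \<open>I\<close>: those with \<open>i < q\<close> by assumption, those with
    \<open>i > q\<close> because they involve some \<open>g s'\<close> with
    \<open>s' < s\<close>.\<close>
  have low: "?x ^ Suc s * g s \<in> I (Suc s + j)" for s
  proof (induction s rule: less_induct)
    case (less s)
    have hx: "hf n s (?x ^ s)"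
      using hf_power[OF hf_coord[OF q], of s] by simp
    have *: "?x ^ s * (if i \<le> s + q then coord n i * g (s + q - i) else 0) \<in> I (Suc s + j)"
      if i: "i \<le> n" "i \<noteq> q" for i
    proof -
      consider "i < q" | "i > s + q" | "q < i" "i \<le> s + q"
        using i by linarith
      then show ?thesis
      proof cases
        case 1
        then show ?thesis using mult_in[OF Suc.prems(4) hx] by simp
      next
        case 3
        define s' where "s' = s + q - i"
        have s': "s = s' + (i - q)" "s' < s"
          using 3 by (auto simp: s'_def)
        have idx: "Suc (i - q - 1) + (Suc s' + j) = Suc s + j"
          using 3 s' by linarith
        have "hf n (i - q - 1) (?x ^ (i - q - 1))"
          using hf_power[OF hf_coord[OF q], of "i - q - 1"] by simp
        from mult_in[OF less[OF s'(2)] hf_coord_mult[OF i(1) this]]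
        have "coord n i * ?x ^ (i - q - 1) * (?x ^ Suc s' * g s') \<in> I (Suc s + j)"
          unfolding idx .
        moreover have "?x ^ s = ?x ^ (i - q - 1) * ?x ^ Suc s'"
        proof -
          have "s = i - q - 1 + Suc s'" using 3 s' by linarith
          then show ?thesis by (simp only: power_add)
        qed
        ultimately show ?thesis
          using 3 by (simp only: if_True flip: s'_def) (simp only: ac_simps)
      qed (use zero_in in auto)
    qed
    have "?x ^ s * lmul g (s + q) = ?x ^ Suc s * g s +
        (\<Sum>i\<in>{..n} - {q}. ?x ^ s * (if i \<le> s + q then coord n i * g (s + q - i) else 0))"
      using q unfolding lmul_def sum_distrib_left
      by (subst sum.remove[of _ q]) (auto simp: algebra_simps)
    then have "?x ^ Suc s * g s = ?x ^ s * lmul g (s + q) -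
        (\<Sum>i\<in>{..n} - {q}. ?x ^ s * (if i \<le> s + q then coord n i * g (s + q - i) else 0))"
      by simp
    moreover have "?x ^ s * lmul g (s + q) \<in> I (Suc s + j)"
      using mult_in[OF Suc.prems(3) hx] by simp
    ultimately show ?case
      using * by (auto intro!: diff_in sum_in)
  qed
  \<comment> \<open>Descending induction on \<open>e\<close>, starting from a power of
    \<open>?x\<close> that annihilates all coefficients at once. If the power \<open>Suc e\<close>
    does, then \<open>?x\<close> annihilates \<open>?x ^ e * g s\<close>, and the outer induction
    with \<open>Suc q\<close> applies.\<close>
  have *: "?x ^ e * g s \<in> I (e + j)" if "e \<le> Suc M" for e s
    using that
  proof (induction arbitrary: s rule: inc_induct)
    case base
    show ?case
    proof (cases "s \<le> M")
      case True
      have "hf n (M - s) (?x ^ (M - s))"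
        using hf_power[OF hf_coord[OF q], of "M - s"] by simp
      from mult_in[OF low[of s] this] show ?thesis
        using True by (simp add: mult.assoc[symmetric] flip: power_add power_Suc)
    qed (use Suc.prems(2) zero_in in auto)
  next
    case (step e)
    have he: "hf n e (?x ^ e)"
      using hf_power[OF hf_coord[OF q], of e] by simp
    show ?case
    proof (rule Suc.hyps(1)[of "Suc q"])
      show "lmul (\<lambda>s. ?x ^ e * g s) u \<in> I (Suc (e + j))" for u
        using mult_in[OF Suc.prems(3) he, of u] by (simp add: lmul_mult)
      show "coord n i * (?x ^ e * g s) \<in> I (Suc (e + j))" if "i < Suc q" for i s
      proof (cases "i = q")
        case True
        then show ?thesis using step.IH[of s] by (simp add: mult.assoc)
      next
        case False
        then show ?thesis
          using mult_in[OF Suc.prems(4) he, of i s] that by (simp add: algebra_simps)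
      qed
    qed (use Suc q in auto)
  qed
  show ?case using *[of 0 s] by simp
qed

lemma lmul_cancel:
  "(\<And>s. s > M \<Longrightarrow> g s = 0) \<Longrightarrow> (\<And>u. lmul g u \<in> I (Suc j)) \<Longrightarrow> g s \<in> I j"
  by (rule lmul_cancel_aux[of 0]) auto

lemma lmul_eq_0: "(\<And>s. s > M \<Longrightarrow> g s = 0) \<Longrightarrow> u > M + n \<Longrightarrow> lmul g u = 0"
  by (auto simp: lmul_def intro!: sum.neutral)

lemma lmul_pow_eq_0:
  "(\<And>s. s > M \<Longrightarrow> g s = 0) \<Longrightarrow> u > M + N * n \<Longrightarrow> (lmul ^^ N) g u = 0"
proof (induction N arbitrary: u)
  case (Suc N)
  then show ?case using lmul_eq_0[of "M + N * n" "(lmul ^^ N) g" u] by simp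
qed auto

lemma lmul_pow_cancel:
  "(\<And>s. s > M \<Longrightarrow> g s = 0) \<Longrightarrow> (\<And>u. (lmul ^^ N) g u \<in> I (N + j)) \<Longrightarrow> g s \<in> I j"
proof (induction N arbitrary: s)
  case (Suc N)
  have "(lmul ^^ N) g u \<in> I (N + j)" for u
    by (rule lmul_cancel[of "M + N * n"]) (use Suc.prems lmul_pow_eq_0[of M g] in auto)
  then show ?case using Suc by blast
qed auto

lemma lmul_pow_sum:
  "(lmul ^^ N) (\<lambda>s. \<Sum>x\<in>X. cst (c x) * g x s) = (\<lambda>u. \<Sum>x\<in>X. cst (c x) * (lmul ^^ N) (g x) u)"
proof (induction N)
  case (Suc N)
  have "lmul (\<lambda>s. \<Sum>x\<in>X. cst (c x) * (lmul ^^ N) (g x) s) u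
      = (\<Sum>x\<in>X. cst (c x) * lmul ((lmul ^^ N) (g x)) u)" for u
  proof -
    have "lmul (\<lambda>s. \<Sum>x\<in>X. cst (c x) * (lmul ^^ N) (g x) s) u =
      (\<Sum>i\<le>n. \<Sum>x\<in>X. cst (c x) * (if i \<le> u then coord n i * (lmul ^^ N) (g x) (u - i) else 0))"
      unfolding lmul_def by (intro sum.cong) (auto simp: sum_distrib_left mult.left_commute)
    then show ?thesis
      by (subst (asm) sum.swap) (simp add: lmul_def sum_distrib_left)
  qed
  then show ?case by (simp add: Suc)
qed auto

lemma hf_lmul_pow: "(\<And>s. hf n j (g s)) \<Longrightarrow> hf n (N + j) ((lmul ^^ N) g u)"
  by (induction N arbitrary: u) (auto simp: lmul_def intro!: hf_sum hf.zero hf_coord_mult[simplified])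

text \<open>The bound \<open>r\<close> passes down from degree \<open>N + j\<close> to degree
  \<open>j\<close> because the \<open>N\<close>-th power of the generic linear form acts injectively
  modulo \<open>I\<close>. That power also raises the degree in \<open>t\<close>, so whole spaces of
  \<open>t\<close>-polynomials are compared.\<close>

theorem hilbert_function_growth:
  fixes w :: "nat \<Rightarrow> cfun" and f :: "'x \<Rightarrow> cfun"
  assumes span: "\<And>g. hf n (N + j) g \<Longrightarrow> \<exists>a. g - (\<Sum>v<r. cst (a v) * w v) \<in> I (N + j)"
    and X: "finite X" "r < card X" and f: "\<And>x. x \<in> X \<Longrightarrow> hf n j (f x)"
  shows "\<exists>c. (\<exists>x\<in>X. c x \<noteq> 0) \<and> (\<Sum>x\<in>X. cst (c x) * f x) \<in> I j"
proof -
  text \<open>Modulo \<open>I\<close>, the \<open>t\<close>-polynomials of degree at most \<open>M\<close> with coefficients in the span of the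
    \<open>f x\<close> are mapped to a space of dimension at most \<open>r (M + N n + 1)\<close>.\<close>
  define M where "M = r * (N * n)"
  define D where "D = Suc (M + N * n)"
  define Y where "Y = X \<times> {..M}"
  define F :: "'x \<times> nat \<Rightarrow> nat \<Rightarrow> cfun"
    where "F = (\<lambda>(x, s) s'. if s' = s then f x else 0)"
  \<comment> \<open>The choice of \<open>M\<close> makes the difference exactly 1, so there are more
    unknowns than equations.\<close>
  have "r * D < Suc r * Suc M"
    by (simp add: D_def M_def algebra_simps)
  also have "\<dots> \<le> card X * Suc M"
    using X by (intro mult_right_mono) auto
  also have "\<dots> = card Y"
    using X by (simp add: Y_def card_cartesian_product)
  finally have card: "r * D < card Y" .
  have fin: "finite Y" using X by (simp add: Y_def)
  have "\<exists>a. \<forall>y\<in>Y. \<forall>u. (lmul ^^ N) (F y) u - (\<Sum>v<r. cst (a y u v) * w v) \<in> I (N + j)"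
  proof -
    have "\<exists>a. y \<in> Y \<longrightarrow> (lmul ^^ N) (F y) u - (\<Sum>v<r. cst (a v) * w v) \<in> I (N + j)" for y u
    proof (cases "y \<in> Y")
      case True
      have "hf n (N + j) ((lmul ^^ N) (F y) u)"
        using True f by (intro hf_lmul_pow) (auto simp: F_def Y_def intro: hf.zero)
      then show ?thesis using span by blast
    qed auto
    then show ?thesis by metis
  qed
  then obtain a where a:
    "\<And>y u. y \<in> Y \<Longrightarrow> (lmul ^^ N) (F y) u - (\<Sum>v<r. cst (a y u v) * w v) \<in> I (N + j)" by blast
  \<comment> \<open>Each coefficient \<open>u\<close> of the product and each spanning form
    \<open>w v\<close> give one equation, numbered \<open>e = u * r + v\<close>.\<close>
  obtain c where c: "\<exists>y\<in>Y. c y \<noteq> 0"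
      "\<And>e. e < r * D \<Longrightarrow> (\<Sum>y\<in>Y. c y * a y (e div r) (e mod r)) = 0"
    using homogeneous_system[OF fin card, of "\<lambda>y e. a y (e div r) (e mod r)"] by blast
  have c0: "(\<Sum>y\<in>Y. c y * a y u v) = 0" if "u < D" "v < r" for u v
  proof -
    have "u * r + v < Suc u * r" using that by simp
    also have "\<dots> \<le> r * D" using that mult_le_mono1[of "Suc u" D r] by (simp add: mult.commute)
    finally show ?thesis using c(2)[of "u * r + v"] that by simp
  qed
  define g where "g s = (\<Sum>y\<in>Y. cst (c y) * F y s)" for s
  have g0: "g s = 0" if "s > M" for s
    unfolding g_def by (rule sum.neutral) (use that in \<open>auto simp: Y_def F_def\<close>)
  have "(lmul ^^ N) g u \<in> I (N + j)" for u
  proof (cases "u < D")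
    case True
    have "(\<Sum>y\<in>Y. cst (c y) * ((lmul ^^ N) (F y) u - (\<Sum>v<r. cst (a y u v) * w v))) \<in> I (N + j)"
      using a by (intro sum_in cst_mult_in) auto
    also have "(\<Sum>y\<in>Y. cst (c y) * ((lmul ^^ N) (F y) u - (\<Sum>v<r. cst (a y u v) * w v)))
       = (lmul ^^ N) g u - (\<Sum>y\<in>Y. \<Sum>v<r. cst (c y * a y u v) * w v)"
      unfolding g_def lmul_pow_sum
      by (simp add: right_diff_distrib sum_subtractf sum_distrib_left cst_mult mult.assoc)
    also have "(\<Sum>y\<in>Y. \<Sum>v<r. cst (c y * a y u v) * w v) = (\<Sum>v<r. cst (\<Sum>y\<in>Y. c y * a y u v) * w v)"
      by (subst sum.swap) (simp add: fun_eq_iff sum_fun_apply cst_def ring_fun_apply sum_distrib_right)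
    also have "\<dots> = 0"
      using True by (simp add: c0)
    finally show ?thesis by simp
  next
    case False
    then show ?thesis using lmul_pow_eq_0[of M g N u] g0 zero_in by (simp add: D_def)
  qed
  then have gI: "g s \<in> I j" for s
    using lmul_pow_cancel[of M g N j] g0 by blast
  have "g s = (\<Sum>x\<in>X. cst (c (x, s)) * f x)" if "s \<le> M" for s
  proof -
    have "g s = (\<Sum>x\<in>X. \<Sum>s'\<le>M. cst (c (x, s')) * (if s = s' then f x else 0))"
      unfolding g_def Y_def F_def by (subst sum.cartesian_product) (auto intro!: sum.cong)
    then show ?thesis
      using that by (simp add: if_distrib[of "\<lambda>y. _ * y"] cong: if_cong)
  qed
  \<comment> \<open>The coefficient of \<open>t^s\<close> in \<open>g\<close>, for an
    \<open>s\<close> with some \<open>c (x, s)\<close> nonzero, is the relation sought.\<close>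
  moreover obtain x s where "x \<in> X" "s \<le> M" "c (x, s) \<noteq> 0"
    using c(1) by (auto simp: Y_def)
  ultimately show ?thesis
    using gI[of s] by (intro exI[of _ "\<lambda>x. c (x, s)"]) auto
qed

end


section \<open>Subschemes of the Veronese variety\<close>

lemma forms_subset_span:
  "(forms B k :: ('x, complex) mpoly set) \<subseteq> pm.span ((\<lambda>m. Poly_Mapping.single m 1) ` monomials B k)"
  (is "_ \<subseteq> ?S")
proof
  fix f :: "('x, complex) mpoly"
  assume "f \<in> forms B k"
  then have "\<forall>m\<in>Poly_Mapping.keys f. m \<in> monomials B k" by (auto simp: forms_def)
  moreover have "f = (\<Sum>m\<in>Poly_Mapping.keys f.
      scale (Poly_Mapping.lookup f m) (Poly_Mapping.single m 1))"
    by (subst poly_mapping_sum_single) (simp add: scale_eq_mult mult_single)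
  ultimately show "f \<in> ?S"
    by (metis (no_types, lifting) imageI pm.span_base pm.span_scale pm.span_sum)
qed

text \<open>A basis of \<open>R \<inter> forms B k\<close> is extended to one of
  \<open>forms B k\<close>; the added vectors are the \<open>w v\<close>, and their number is the
  value of the Hilbert function.\<close>

lemma spanning_modulo:
  fixes R :: "('x, complex) mpoly set"
  assumes "finite B" "pm.subspace (R \<inter> forms B k)"
  obtains w :: "nat \<Rightarrow> ('x, complex) mpoly" where "\<And>f. f \<in> forms B k \<Longrightarrow>
    \<exists>a. f - (\<Sum>v<hilbert_function B R k. scale (a v) (w v)) \<in> R \<inter> forms B k"
proof -
  let ?V = "R \<inter> forms B k"
  obtain B0 where B0: "B0 \<subseteq> ?V" "pm.independent B0" "?V \<subseteq> pm.span B0" "card B0 = pm.dim ?V"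
    by (rule pm.basis_exists)
  obtain B1 where B1: "B0 \<subseteq> B1" "B1 \<subseteq> forms B k" "pm.independent B1" "forms B k \<subseteq> pm.span B1"
    using pm.maximal_independent_subset_extend[of B0 "forms B k"] B0 by blast
  have fin: "finite B1"
    using pm.independent_span_bound[OF _ B1(3), of "(\<lambda>m. Poly_Mapping.single m 1) ` monomials B k"]
      B1(2) forms_subset_span[of B k] finite_monomials[OF assms(1)] by auto
  have card: "card (B1 - B0) = hilbert_function B R k"
    using B0(4) pm.basis_card_eq_dim[OF B1(2,4,3)] B1(1) fin
    by (simp add: hilbert_function_def card_Diff_subset finite_subset)
  then obtain w where w: "bij_betw w {..<hilbert_function B R k} (B1 - B0)"
    using ex_bij_betw_nat_finite[of "B1 - B0"] fin by (metis atLeast0LessThan finite_Diff)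
  show ?thesis
  proof (rule that)
    fix f :: "('x, complex) mpoly"
    assume "f \<in> forms B k"
    then obtain u where u: "f = (\<Sum>b\<in>B1. scale (u b) b)"
      using B1(4) pm.span_finite[OF fin] by auto
    have "(\<Sum>b\<in>B1. scale (u b) b) = (\<Sum>b\<in>B1 - B0. scale (u b) b) + (\<Sum>b\<in>B0. scale (u b) b)"
      by (rule sum.subset_diff[OF B1(1) fin])
    also have "(\<Sum>b\<in>B1 - B0. scale (u b) b)
        = (\<Sum>v<hilbert_function B R k. scale (u (w v)) (w v))"
      by (rule sum.reindex_bij_betw[OF w, symmetric])
    finally have "f - (\<Sum>v<hilbert_function B R k. scale (u (w v)) (w v)) = (\<Sum>b\<in>B0. scale (u b) b)"
      by (simp add: u)
    also have "\<dots> \<in> ?V"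
      using B0(1) by (intro pm.subspace_sum[OF assms(2)] pm.subspace_scale[OF assms(2)]) auto
    finally show "\<exists>a. f - (\<Sum>v<hilbert_function B R k. scale (a v) (w v)) \<in> ?V"
      by (rule exI[of _ "\<lambda>v. u (w v)"])
  qed
qed

locale veronese_scheme =
  fixes n d r :: nat and R :: "(nat \<Rightarrow>\<^sub>0 nat, complex) mpoly set"
  assumes d_pos: "d > 0"
    and scheme: "zero_dim_scheme (monomials {..n} d) R r"
    and contained: "contained_in (monomials {..n} d) R (veronese n d)"
begin

abbreviation "T \<equiv> monomials {..n} d"

lemma fin_T: "finite T"
  by (simp add: finite_monomials)

lemma hom: "hom_ideal T R" and sat: "saturation T R = R" and len: "has_length T R r"
  using scheme by (auto simp: zero_dim_scheme_def)

lemma R_add: "f \<in> R \<Longrightarrow> g \<in> R \<Longrightarrow> f + g \<in> R"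
  using hom by (auto simp: hom_ideal_def)

lemma R_mult: "f \<in> R \<Longrightarrow> g \<in> polys T \<Longrightarrow> g * f \<in> R"
  using hom by (auto simp: hom_ideal_def)

lemma R_scale: "f \<in> R \<Longrightarrow> scale c f \<in> R"
  unfolding scale_eq_mult by (rule R_mult) (simp_all add: polys_def)

lemma subspace_R: "pm.subspace R"
  using hom R_add R_scale by (auto simp: pm.subspace_def hom_ideal_def)

lemma subspace_R_forms: "pm.subspace (R \<inter> forms T k)"
  by (rule pm.subspace_inter[OF subspace_R subspace_forms])

text \<open>Restriction to the Veronese variety, parametrized by the coefficients of the linear
  form.\<close>

definition pullback :: "(nat \<Rightarrow>\<^sub>0 nat, complex) mpoly \<Rightarrow> cfun" where
  "pullback f = (\<lambda>a. ev (lin n a ^ d) f)"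

lemma pullback_add: "pullback (f + g) = pullback f + pullback g"
  by (simp add: pullback_def ev_add fun_eq_iff ring_fun_apply)

lemma pullback_mult: "pullback (f * g) = pullback f * pullback g"
  by (simp add: pullback_def ev_mult fun_eq_iff ring_fun_apply)

lemma pullback_scale: "pullback (scale c f) = cst c * pullback f"
  by (simp add: pullback_def ev_scale cst_def fun_eq_iff ring_fun_apply)

lemma pullback_0 [simp]: "pullback 0 = 0"
  by (simp add: pullback_def fun_eq_iff ring_fun_apply)

lemma pullback_diff: "pullback (f - g) = pullback f - pullback g"
  using pullback_add[of "f - g" g] by simp

lemma pullback_sum: "pullback (\<Sum>i\<in>S. f i) = (\<Sum>i\<in>S. pullback (f i))"
  by (induction S rule: infinite_finite_induct) (auto simp: pullback_add)

lemma pullback_single: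
  "M \<in> monomials T k \<Longrightarrow> pullback (Poly_Mapping.single M c) =
    cst c * (\<Prod>m\<in>Poly_Mapping.keys M. (cst (multinomial n m) * monof n m) ^ Poly_Mapping.lookup M m)"
  by (auto simp: pullback_def mon_def lookup_lin_power fun_eq_iff ring_fun_apply cst_def monomials_def
      prod_fun_apply power_fun_apply intro!: prod.cong)

lemma hf_pullback:
  assumes "f \<in> forms T k"
  shows "hf n (d * k) (pullback f)"
proof -
  have "hf n (d * k) (pullback (Poly_Mapping.single M c))" if M: "M \<in> monomials T k" for M c
  proof -
    have "hf n (\<Sum>m\<in>Poly_Mapping.keys M. Poly_Mapping.lookup M m * d)
      (\<Prod>m\<in>Poly_Mapping.keys M. (cst (multinomial n m) * monof n m) ^ Poly_Mapping.lookup M m)"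
      using M by (intro hf_prod hf_power hf_cst_mult hf_monof) (auto simp: monomials_def)
    moreover have "(\<Sum>m\<in>Poly_Mapping.keys M. Poly_Mapping.lookup M m * d) = d * k"
      using M by (auto simp: monomials_def mdeg_def mult.commute sum_distrib_left)
    ultimately show ?thesis
      using M by (simp add: pullback_single hf_cst_mult)
  qed
  then have "hf n (d * k) (pullback (\<Sum>m\<in>Poly_Mapping.keys f.
      Poly_Mapping.single m (Poly_Mapping.lookup f m)))"
    unfolding pullback_sum using assms by (intro hf_sum) (auto simp: forms_def)
  then show ?thesis by (simp flip: poly_mapping_sum_single)
qed

lemma pullback_coordinate:
  "m \<in> T \<Longrightarrow> pullback (Poly_Mapping.single (Poly_Mapping.single m 1) (1 / multinomial n m)) = monof n m"
  by (subst pullback_single[of _ 1]) (auto simp: mult.assoc[symmetric] simp flip: cst_mult)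

text \<open>A monomial of degree \<open>d * k\<close> is a product of \<open>k\<close> monomials of
  degree \<open>d\<close>, each a multiple of a restricted coordinate.\<close>

lemma pullback_surj_monof:
  "m \<in> monomials {..n} (d * k) \<Longrightarrow> \<exists>f\<in>forms T k. pullback f = monof n m"
proof (induction k arbitrary: m)
  case 0
  then show ?case
    by (intro bexI[of _ "Poly_Mapping.single 0 1"])
      (auto simp: pullback_single[of _ 0] single_in_forms simp del: single_one)
next
  case (Suc k)
  obtain m1 m2 where m: "m1 \<in> T" "m2 \<in> monomials {..n} (d * k)" "m = m1 + m2"
    using Suc.prems by (auto elim: monomials_addE)
  let ?f = "Poly_Mapping.single (Poly_Mapping.single m1 1) (1 / multinomial n m1)"
  obtain g where g: "g \<in> forms T k" "pullback g = monof n m2"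
    using Suc.IH[OF m(2)] by blast
  have "?f \<in> forms T 1" using m(1) by (intro single_in_forms) simp
  from forms_mult[OF this g(1)] have "?f * g \<in> forms T (Suc k)" by simp
  moreover have "pullback (?f * g) = monof n m"
    by (simp only: pullback_mult pullback_coordinate[OF m(1)] g(2) m(3) monof_add)
  ultimately show ?case by blast
qed

lemma pullback_surj:
  assumes "hf n (d * k) f"
  obtains f' where "f' \<in> forms T k" "pullback f' = f"
  using assms
proof (induction arbitrary: thesis)
  case (monof m c)
  then obtain f where "f \<in> forms T k" "pullback f = monof n m"
    using pullback_surj_monof by blast
  then show ?case
    using monof(2)[of "scale c f"] pm.subspace_scale[OF subspace_forms, of f T k c]
    by (simp add: pullback_scale)
next
  case zero
  then show ?case using pm.subspace_0[OF subspace_forms] pullback_0 by blast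
next
  case (add f g)
  then show ?case by (metis pullback_add pm.subspace_add[OF subspace_forms])
qed

text \<open>Containment in the Veronese variety enters here: a form with zero pullback vanishes at
  all \<open>d\<close>-th powers.\<close>

lemma pullback_eq_0:
  assumes "f \<in> forms T k" "pullback f = 0"
  shows "f \<in> R"
proof -
  have "ev p f = 0" if p: "p \<in> veronese n d" for p
  proof -
    obtain L where "p = L ^ d" "L \<in> forms {..n} 1"
      using p by (auto simp: veronese_def)
    then obtain a where "p = lin n a ^ d"
      using form_1_eq_lin[of L n] by metis
    then show ?thesis
      using fun_cong[OF assms(2), of a] by (simp add: pullback_def zero_fun_apply)
  qed
  then have "f \<in> vanishing_ideal T (veronese n d)"
    using assms(1) forms_subset_polys by (auto simp: vanishing_ideal_def hcomp_form)
  then show ?thesis using contained by (auto simp: contained_in_def)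
qed

section \<open>The ideal of the scheme on projective n-space\<close>

definition Q :: "nat \<Rightarrow> cfun set" where
  "Q k = pullback ` (R \<inter> forms T k)"

text \<open>Forms with equal pullbacks differ by an element of \<open>R\<close>, so passing from
  \<open>R\<close> to \<open>Q\<close> loses nothing.\<close>

lemma pullback_in_Q_iff:
  assumes "f \<in> forms T k"
  shows "pullback f \<in> Q k \<longleftrightarrow> f \<in> R"
proof
  assume "pullback f \<in> Q k"
  then obtain g where g: "g \<in> R" "g \<in> forms T k" "pullback f = pullback g"
    by (auto simp: Q_def)
  have "f - g \<in> R"
    using g assms by (intro pullback_eq_0[of _ k])
      (auto simp: pullback_diff intro: pm.subspace_diff[OF subspace_forms])
  then show "f \<in> R" using R_add[OF _ g(1)] by force
qed (use assms in \<open>auto simp: Q_def\<close>)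

lemma Q_0: "0 \<in> Q k"
  using pm.subspace_0[OF subspace_R_forms] pullback_0 unfolding Q_def by (metis image_eqI)

lemma Q_add: "f \<in> Q k \<Longrightarrow> g \<in> Q k \<Longrightarrow> f + g \<in> Q k"
  unfolding Q_def
  by (auto simp flip: pullback_add intro!: imageI pm.subspace_add[OF subspace_forms] R_add)

lemma Q_sum: "(\<And>i. i \<in> S \<Longrightarrow> f i \<in> Q k) \<Longrightarrow> (\<Sum>i\<in>S. f i) \<in> Q k"
  by (induction S rule: infinite_finite_induct) (auto intro: Q_0 Q_add)

text \<open>The saturated ideal of the scheme in the coordinates of \<open>\<P>\<^sup>n\<close>; in degrees divisible
  by \<open>d\<close> it restricts to \<open>Q\<close>.\<close>

definition I :: "nat \<Rightarrow> cfun set" where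
  "I j = {f. eventually (\<lambda>k. \<forall>i g. j + i = d * k \<longrightarrow> hf n i g \<longrightarrow> f * g \<in> Q k) sequentially}"

lemma saturated_ideal_I: "saturated_ideal n I"
proof
  show "0 \<in> I j" for j by (simp add: I_def Q_0)
  show "f + g \<in> I j" if "f \<in> I j" "g \<in> I j" for f g j
    using that unfolding I_def mem_Collect_eq
    by eventually_elim (auto simp: distrib_right intro: Q_add)
  show "g * f \<in> I (i + j)" if "f \<in> I j" "hf n i g" for f g i j
    using that(1) unfolding I_def mem_Collect_eq
  proof eventually_elim
    case (elim k)
    show ?case
    proof (intro allI impI)
      fix i' h assume "i + j + i' = d * k" "hf n i' h"
      then show "g * f * h \<in> Q k"
        using elim[rule_format, of "i + i'" "g * h"] hf_mult[OF that(2), of i' h]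
        by (simp add: algebra_simps)
    qed
  qed
  show "f \<in> I j" if "\<And>i. i \<le> n \<Longrightarrow> coord n i * f \<in> I (Suc j)" for f j
  proof -
    \<comment> \<open>There are finitely many coordinates, so one threshold for \<open>k\<close>
      serves them all. Moreover \<open>k > j\<close> forces \<open>g\<close> to have positive degree
      and hence to split along the coordinates.\<close>
    have "eventually (\<lambda>k. \<forall>l\<in>{..n}. \<forall>i g. Suc j + i = d * k \<longrightarrow> hf n i g \<longrightarrow>
        coord n l * f * g \<in> Q k) sequentially"
      using that by (intro eventually_ball_finite) (auto simp: I_def)
    then show ?thesis
      unfolding I_def mem_Collect_eq using eventually_gt_at_top[of j]
    proof eventually_elim
      case (elim k)
      show ?case
      proof (intro allI impI)
        fix i g assume i: "j + i = d * k" "hf n i g"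
        have "k \<le> d * k" using d_pos by simp
        with i(1) elim(2) obtain i' where i': "i = Suc i'" by (cases i) auto
        obtain h where h: "\<And>l. l \<le> n \<Longrightarrow> hf n i' (h l)" "g = (\<Sum>l\<le>n. coord n l * h l)"
          using hf_SucE i(2) i' by metis
        have "(\<Sum>l\<le>n. coord n l * f * h l) \<in> Q k"
          using elim(1) h(1) i(1) i' by (intro Q_sum) auto
        then show "f * g \<in> Q k"
          by (simp add: h(2) sum_distrib_left algebra_simps)
      qed
    qed
  qed
qed

sublocale saturated_ideal n I
  by (rule saturated_ideal_I)

text \<open>Forms whose degree is a multiple of \<open>d\<close> are pullbacks, and multiplying by
  them stays in the ideal \<open>R\<close>.\<close>

lemma Q_subset_I: "Q k \<subseteq> I (d * k)"
proof
  fix f assume "f \<in> Q k"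
  then obtain f' where f': "f' \<in> R" "f' \<in> forms T k" "f = pullback f'"
    by (auto simp: Q_def)
  have *: "f * g \<in> Q k'" if k: "k' \<ge> k" "d * k + i = d * k'" "hf n i g" for k' i g
  proof -
    obtain l where l: "k' = k + l" using k(1) by (auto simp: le_iff_add)
    then have "i = d * l" using k(2) by (simp add: distrib_left)
    then obtain g' where g': "g' \<in> forms T l" "pullback g' = g"
      using pullback_surj k(3) by blast
    have "g' * f' \<in> R" using R_mult f'(1) g'(1) forms_subset_polys by blast
    moreover have "f' * g' \<in> forms T k'" using forms_mult f'(2) g'(1) l by blast
    ultimately have "f' * g' \<in> R \<inter> forms T k'" by (simp add: mult.commute)
    then show ?thesis
      unfolding Q_def f'(3) g'(2)[symmetric] pullback_mult[symmetric] by (rule imageI)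
  qed
  show "f \<in> I (d * k)"
    unfolding I_def mem_Collect_eq by (rule eventually_mono[OF eventually_ge_at_top[of k]]) (use * in blast)
qed

text \<open>A single degree \<open>k' = k + l\<close> suffices: all of \<open>forms T l\<close>
  multiplies \<open>f'\<close> into \<open>R\<close>, and \<open>R\<close> is saturated.\<close>

lemma I_imp_Q:
  assumes "f \<in> I (d * k)" "hf n (d * k) f"
  shows "f \<in> Q k"
proof -
  obtain f' where f': "f' \<in> forms T k" "pullback f' = f"
    using pullback_surj assms(2) by blast
  have "eventually (\<lambda>k'. k' \<ge> k \<and> (\<forall>i g. d * k + i = d * k' \<longrightarrow> hf n i g \<longrightarrow> f * g \<in> Q k')) sequentially"
    using assms(1) by (auto simp: I_def intro: eventually_conj eventually_ge_at_top)
  then obtain k' where k': "k' \<ge> k"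
      "\<And>i g. d * k + i = d * k' \<Longrightarrow> hf n i g \<Longrightarrow> f * g \<in> Q k'"
    using eventually_happens'[OF sequentially_bot] by blast
  obtain l where l: "k' = k + l" using k'(1) by (auto simp: le_iff_add)
  have "g * f' \<in> R" if g: "g \<in> forms T l" for g
  proof -
    have "pullback (g * f') \<in> Q k'"
      using k'(2)[OF _ hf_pullback[OF g]] l f'(2) by (simp add: pullback_mult mult.commute distrib_left)
    moreover have "g * f' \<in> forms T k'"
      using forms_mult[OF g f'(1)] l by (simp add: add.commute)
    ultimately show ?thesis by (simp add: pullback_in_Q_iff)
  qed
  then have "f' \<in> saturation T R"
    using f'(1) forms_subset_polys by (auto simp: saturation_def)
  then show ?thesis
    using f' pullback_in_Q_iff sat by auto
qed

theorem codimension_bound: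
  assumes "finite X" "r < card X" "\<And>x. x \<in> X \<Longrightarrow> hf n j (f x)"
  shows "\<exists>c. (\<exists>x\<in>X. c x \<noteq> 0) \<and> (\<Sum>x\<in>X. cst (c x) * f x) \<in> I j"
proof -
  obtain k0 where k0: "\<And>k. k \<ge> k0 \<Longrightarrow> hilbert_function T R k = r"
    using len by (auto simp: has_length_def)
  \<comment> \<open>Past \<open>k0\<close> the Hilbert function equals \<open>r\<close>; past
    \<open>j\<close> the degree \<open>d * k\<close> is at least \<open>j\<close>, from where the
    bound passes down.\<close>
  define k where "k = max k0 j"
  have "j \<le> d * k" using d_pos mult_le_mono[of 1 d j k] by (simp add: k_def)
  then obtain N where N: "N + j = d * k" by (metis le_add_diff_inverse2)
  obtain w where w: "\<And>f. f \<in> forms T k \<Longrightarrow>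
      \<exists>a. f - (\<Sum>v<r. scale (a v) (w v)) \<in> R \<inter> forms T k"
    using spanning_modulo[OF fin_T subspace_R_forms, of k] k0[of k] by (auto simp: k_def)
  show ?thesis
  proof (rule hilbert_function_growth[OF _ assms])
    fix g assume "hf n (N + j) g"
    then obtain g' where g': "g' \<in> forms T k" "pullback g' = g"
      using pullback_surj N by metis
    then obtain a where "g' - (\<Sum>v<r. scale (a v) (w v)) \<in> R \<inter> forms T k"
      using w by blast
    then have "pullback (g' - (\<Sum>v<r. scale (a v) (w v))) \<in> Q k"
      by (simp add: Q_def)
    then show "\<exists>a. g - (\<Sum>v<r. cst (a v) * pullback (w v)) \<in> I (N + j)"
      using Q_subset_I[of k] N g'(2)
      by (auto simp: pullback_diff pullback_sum pullback_scale)
  qed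
qed

end


section \<open>The apolarity functional\<close>

locale veronese_span = veronese_scheme +
  fixes F :: "(nat, complex) mpoly"
  assumes in_span: "F \<in> linear_span T R"
begin

text \<open>\<open>F\<close> as a functional on forms of degree \<open>d\<close>. The choice is
  harmless: two candidates differ by a linear form in \<open>R\<close>, which vanishes at
  \<open>F\<close>.\<close>

definition phi :: "cfun \<Rightarrow> complex" where
  "phi f = ev F (SOME l. l \<in> forms T 1 \<and> pullback l = f)"

lemma phi_pullback:
  assumes "l \<in> forms T 1"
  shows "phi (pullback l) = ev F l"
proof -
  define l' where "l' = (SOME l'. l' \<in> forms T 1 \<and> pullback l' = pullback l)"
  have l': "l' \<in> forms T 1" "pullback l' = pullback l"
    using someI[of "\<lambda>l'. l' \<in> forms T 1 \<and> pullback l' = pullback l" l] assms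
    by (auto simp: l'_def)
  have "l' - l \<in> forms T 1"
    using pm.subspace_diff[OF subspace_forms l'(1) assms] .
  moreover from this have "l' - l \<in> R"
    using l'(2) by (intro pullback_eq_0[of _ 1]) (auto simp: pullback_diff)
  ultimately have "ev F (l' - l) = 0"
    using in_span by (auto simp: linear_span_def)
  then have "ev F l' = ev F l"
    using ev_add[of F "l' - l" l] by simp
  then show ?thesis by (simp add: phi_def l'_def)
qed

lemma pullback_surj_1:
  assumes "hf n d f"
  obtains l where "l \<in> forms T 1" "pullback l = f"
  using pullback_surj[of 1 f] assms by auto

lemma phi_add: "hf n d f \<Longrightarrow> hf n d g \<Longrightarrow> phi (f + g) = phi f + phi g"
proof -
  assume "hf n d f" "hf n d g"
  then obtain l l' where l: "l \<in> forms T 1" "pullback l = f" and l': "l' \<in> forms T 1" "pullback l' = g"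
    by (metis pullback_surj_1)
  have "phi (pullback (l + l')) = ev F (l + l')"
    by (rule phi_pullback[OF pm.subspace_add[OF subspace_forms l(1) l'(1)]])
  then show ?thesis
    using phi_pullback[OF l(1)] phi_pullback[OF l'(1)] by (simp add: pullback_add ev_add l(2) l'(2))
qed

lemma phi_cst_mult: "hf n d f \<Longrightarrow> phi (cst c * f) = c * phi f"
proof -
  assume "hf n d f"
  then obtain l where l: "l \<in> forms T 1" "pullback l = f"
    by (metis pullback_surj_1)
  have "phi (pullback (scale c l)) = ev F (scale c l)"
    by (rule phi_pullback[OF pm.subspace_scale[OF subspace_forms l(1)]])
  then show ?thesis
    using phi_pullback[OF l(1)] by (simp add: pullback_scale ev_scale l(2))
qed

lemma phi_0 [simp]: "phi 0 = 0"
  using phi_cst_mult[OF hf.zero, of 0] by simp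

lemma phi_sum: "(\<And>i. i \<in> S \<Longrightarrow> hf n d (f i)) \<Longrightarrow> phi (\<Sum>i\<in>S. f i) = (\<Sum>i\<in>S. phi (f i))"
  by (induction S rule: infinite_finite_induct) (auto simp: phi_add hf_sum)

lemma phi_monof:
  assumes "m \<in> T"
  shows "phi (monof n m) = Poly_Mapping.lookup F m / multinomial n m"
  using phi_pullback[OF single_in_forms, of "Poly_Mapping.single m 1" "1 / multinomial n m"]
    assms by (simp add: pullback_coordinate[simplified])

lemma phi_I:
  assumes "f \<in> I d" "hf n d f"
  shows "phi f = 0"
proof -
  have "f \<in> Q 1" using I_imp_Q[of f 1] assms by simp
  then obtain l where "l \<in> R" "l \<in> forms T 1" "f = pullback l"
    by (auto simp: Q_def)
  then show ?thesis
    using phi_pullback in_span by (auto simp: linear_span_def)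
qed

text \<open>At least \<open>r\<close> forms of degree \<open>j\<close> with a dual family for the apolarity pairing form a basis
  modulo \<open>I\<close>, so that every form of degree \<open>j\<close> orthogonal to the dual family lies in \<open>I\<close>.\<close>

lemma apolar_imp_in_I:
  fixes E D :: "'x \<Rightarrow> nat \<Rightarrow>\<^sub>0 nat"
  assumes jk: "j + k = d" and Y: "finite Y" "r \<le> card Y"
    and E: "\<And>y. y \<in> Y \<Longrightarrow> E y \<in> monomials {..n} j"
    and D: "\<And>y. y \<in> Y \<Longrightarrow> D y \<in> monomials {..n} k"
    and diag: "\<And>y. y \<in> Y \<Longrightarrow> Poly_Mapping.lookup F (E y + D y) \<noteq> 0"
    and off_diag: "\<And>x y. x \<in> Y \<Longrightarrow> y \<in> Y \<Longrightarrow> x \<noteq> y \<Longrightarrow> Poly_Mapping.lookup F (E x + D y) = 0"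
    and q: "hf n j q" "\<And>y. y \<in> Y \<Longrightarrow> phi (q * monof n (D y)) = 0"
  shows "q \<in> I j"
proof -
  \<comment> \<open>\<open>None\<close> stands for \<open>q\<close> and \<open>Some y\<close> for
    \<open>monof n (E y)\<close>; these are more than \<open>r\<close> forms and so dependent modulo
    \<open>I\<close>.\<close>
  define X where "X = insert None (Some ` Y)"
  define f where "f = case_option q (\<lambda>y. monof n (E y))"
  have cardX: "card X = Suc (card Y)"
    using Y(1) by (simp add: X_def card_image)
  have hff: "hf n j (f x)" if "x \<in> X" for x
    using that q(1) E by (auto simp: X_def f_def intro!: hf_monof)
  obtain c where c: "\<exists>x\<in>X. c x \<noteq> 0" "(\<Sum>x\<in>X. cst (c x) * f x) \<in> I j"
    using codimension_bound[of X j f] Y cardX hff by (auto simp: X_def)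
  let ?S = "\<Sum>x\<in>X. cst (c x) * f x"
  \<comment> \<open>Pairing the relation with \<open>monof n (D y)\<close> leaves only the term of
    \<open>y\<close>, so its coefficient is zero. Then \<open>q\<close> alone remains.\<close>
  have c0: "c (Some y) = 0" if y: "y \<in> Y" for y
  proof -
    let ?p = "\<lambda>x. phi (f x * monof n (D y))"
    have hp: "hf n d (f x * monof n (D y))" if "x \<in> X" for x
      using hf_mult[OF hff[OF that] hf_monof[OF D[OF y]]] jk by simp
    have hS: "hf n j ?S" using hff by (intro hf_sum hf_cst_mult) auto
    have "monof n (D y) * ?S \<in> I d"
      using mult_in[OF c(2) hf_monof[OF D[OF y]]] jk by (simp add: add.commute)
    moreover have "hf n d (monof n (D y) * ?S)"
      using hf_mult[OF hf_monof[OF D[OF y]] hS] jk by (simp add: add.commute)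
    ultimately have "0 = phi (monof n (D y) * ?S)"
      by (simp add: phi_I)
    also have "monof n (D y) * ?S = (\<Sum>x\<in>X. cst (c x) * (f x * monof n (D y)))"
      by (simp add: sum_distrib_left algebra_simps)
    also have "phi \<dots> = (\<Sum>x\<in>X. c x * ?p x)"
      using hp by (subst phi_sum) (auto intro: hf_cst_mult simp: phi_cst_mult)
    also have "\<dots> = (\<Sum>x\<in>Y. c (Some x) * ?p (Some x))"
      using Y(1) q(2)[OF y] by (simp add: X_def f_def sum.reindex)
    also have "\<dots> = (\<Sum>x\<in>Y. if x = y then c (Some y) * ?p (Some y) else 0)"
    proof (rule sum.cong)
      fix x assume x: "x \<in> Y"
      have "E x + D y \<in> T" using monomials_add[OF E[OF x] D[OF y]] jk by simp
      then show "c (Some x) * ?p (Some x) = (if x = y then c (Some y) * ?p (Some y) else 0)"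
        using off_diag[OF x y] by (auto simp: f_def phi_monof simp flip: monof_add)
    qed simp
    also have "\<dots> = c (Some y) * ?p (Some y)"
      using Y(1) y by simp
    finally have "c (Some y) * ?p (Some y) = 0" by simp
    moreover have "E y + D y \<in> T" using monomials_add[OF E[OF y] D[OF y]] jk by simp
    then have "?p (Some y) \<noteq> 0"
      using diag[OF y] by (simp add: f_def phi_monof flip: monof_add)
    ultimately show ?thesis by simp
  qed
  have "?S = cst (c None) * q"
    using Y(1) c0 by (simp add: X_def f_def sum.reindex)
  moreover have "c None \<noteq> 0"
    using c(1) c0 by (auto simp: X_def)
  ultimately have "cst (1 / c None) * ?S = q"
    by (simp add: mult.assoc[symmetric] flip: cst_mult)
  then show ?thesis
    using cst_mult_in[OF c(2), of "1 / c None"] by simp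
qed

end


section \<open>The coefficients of the form\<close>

abbreviation unit_exp :: "nat \<Rightarrow> nat \<Rightarrow>\<^sub>0 nat" where
  "unit_exp x \<equiv> Poly_Mapping.single x 1"

abbreviation uexp :: "nat \<Rightarrow> nat \<Rightarrow> nat \<Rightarrow> nat \<Rightarrow>\<^sub>0 nat" where
  "uexp d p q \<equiv> Poly_Mapping.single d p + Poly_Mapping.single (Suc d) q"

abbreviation vdeg :: "nat \<Rightarrow> (nat \<Rightarrow>\<^sub>0 nat) \<Rightarrow> nat" where
  "vdeg d m \<equiv> \<Sum>i<d. Poly_Mapping.lookup m i"

lemma vdeg_add: "vdeg d (m + m') = vdeg d m + vdeg d m'"
  by (simp add: lookup_add sum.distrib)

lemma vdeg_single: "vdeg d (Poly_Mapping.single x k) = (if x < d then k else 0)"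
  by (simp add: lookup_single when_def)

lemma vdeg_0_cases:
  assumes "m \<in> monomials {..Suc d} k" "vdeg d m = 0"
  obtains p where "p \<le> k" "m = uexp d p (k - p)"
proof -
  let ?p = "Poly_Mapping.lookup m d"
  have deg: "(\<Sum>i\<le>Suc d. Poly_Mapping.lookup m i) = k"
    using assms(1) mdeg_superset[of "{..Suc d}" m] by (simp add: monomials_def del: sum.atMost_Suc)
  have "{..Suc d} = {..<d} \<union> {d, Suc d}" by auto
  then have "(\<Sum>i\<le>Suc d. Poly_Mapping.lookup m i) = vdeg d m + (?p + Poly_Mapping.lookup m (Suc d))"
    by (simp add: sum.union_disjoint)
  with deg assms(2) have k: "?p + Poly_Mapping.lookup m (Suc d) = k" by simp
  have "Poly_Mapping.lookup m i = 0" if "i \<noteq> d" "i \<noteq> Suc d" for i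
  proof (cases "i < d")
    case True
    then show ?thesis using assms(2) by simp
  next
    case False
    then have "i \<notin> Poly_Mapping.keys m" using assms(1) that by (auto simp: monomials_def)
    then show ?thesis by (simp add: in_keys_iff)
  qed
  then have "m = uexp d ?p (k - ?p)"
    using k by (intro poly_mapping_eqI) (auto simp: lookup_add lookup_single when_def)
  moreover have "?p \<le> k" using k by simp
  ultimately show ?thesis by (intro that)
qed

text \<open>Exponent of \<open>v_i u_0^i u_1^(d-1-i)\<close>, the \<open>i\<close>-th term of
  \<open>G d\<close>.\<close>

definition gexp :: "nat \<Rightarrow> nat \<Rightarrow> nat \<Rightarrow>\<^sub>0 nat" where
  "gexp d i = Poly_Mapping.single i 1 + Poly_Mapping.single d i + Poly_Mapping.single (Suc d) (d - 1 - i)"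

lemma Var_power: "Var x ^ k = Poly_Mapping.single (Poly_Mapping.single x k) 1"
  by (induction k) (auto simp: Var_def mult_single simp flip: single_add)

lemma G_eq: "G d = (\<Sum>i<d. Poly_Mapping.single (gexp d i) 1)"
  unfolding G_def gexp_def Var_power by (simp add: Var_def mult_single)

lemma lookup_gexp:
  "i < d \<Longrightarrow> Poly_Mapping.lookup (gexp d i) j =
     (if j < d then of_bool (j = i) else if j = d then i else if j = Suc d then d - 1 - i else 0)"
  by (auto simp: gexp_def lookup_add lookup_single when_def)

lemma gexp_eq_iff: "i < d \<Longrightarrow> j < d \<Longrightarrow> gexp d i = gexp d j \<longleftrightarrow> i = j"
  by (metis lookup_gexp less_irrefl)

lemma lookup_G: "Poly_Mapping.lookup (G d) m = of_bool (\<exists>i<d. m = gexp d i)"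
proof (cases "\<exists>i<d. m = gexp d i")
  case True
  then obtain i where "i < d" "m = gexp d i" by blast
  then show ?thesis
    by (auto simp: G_eq lookup_sum lookup_single when_def gexp_eq_iff sum.delta' cong: sum.cong_simp)
qed (auto simp: G_eq lookup_sum lookup_single when_def intro!: sum.neutral)

lemma gexp_in_monomials: "i < d \<Longrightarrow> gexp d i \<in> monomials {..Suc d} d"
  by (auto simp: gexp_def monomials_def mdeg_add keys_add_nat)

lemma lookup_G_gexp_shape:
  assumes "i < d" "m = Poly_Mapping.single i 1 + Poly_Mapping.single d p + Poly_Mapping.single (Suc d) (d - 1 - p)"
  shows "Poly_Mapping.lookup (G d) m = of_bool (p = i)"
proof -
  have "m = gexp d i" if "m = gexp d j" "j < d" for j
  proof -
    have "Poly_Mapping.lookup m i = 1"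
      using assms by (simp add: lookup_add lookup_single when_def)
    then have "i = j" using that assms(1) by (simp add: lookup_gexp of_bool_def split: if_splits)
    then show ?thesis using that by simp
  qed
  moreover have "Poly_Mapping.lookup m d = p" "Poly_Mapping.lookup (gexp d i) d = i"
    using assms by (simp_all add: lookup_gexp lookup_add lookup_single when_def)
  then have "m = gexp d i \<longleftrightarrow> p = i"
    using assms(2) by (auto simp: gexp_def)
  ultimately show ?thesis
    using assms(1) by (auto simp: lookup_G)
qed

lemma lookup_G_eq_0:
  assumes "(\<Sum>i<d. Poly_Mapping.lookup m i) \<noteq> 1"
  shows "Poly_Mapping.lookup (G d) m = 0"
proof -
  have "(\<Sum>j<d. Poly_Mapping.lookup (gexp d i) j) = 1" if "i < d" for i
    using that by (simp add: lookup_gexp of_bool_def)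
  then show ?thesis using assms by (auto simp: lookup_G)
qed


section \<open>No short scheme spans the form\<close>

locale G_scheme = veronese_span "Suc d" d r R "G d" for d r R +
  assumes d_ge_3: "d \<ge> 3" and r_le: "r \<le> d + 2"
begin

abbreviation "\<alpha> \<equiv> coord (Suc d)"
abbreviation "\<beta> \<equiv> coord (Suc d) d"
abbreviation "\<beta>' \<equiv> coord (Suc d) (Suc d)"

lemma phi_vdeg:
  assumes "m \<in> monomials {..Suc d} d" "vdeg d m \<noteq> 1"
  shows "phi (monof (Suc d) m) = 0"
  using phi_monof[OF assms(1)] lookup_G_eq_0[OF assms(2)] by simp

lemma phi_shape:
  assumes "i < d" "p + q = d - 1"
  shows "phi (monof (Suc d) (unit_exp i + uexp d p q)) = of_bool (p = i) / multinomial (Suc d) (gexp d i)"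
proof -
  have q: "q = d - 1 - p" using assms(2) by simp
  have "unit_exp i + uexp d p q \<in> monomials {..Suc d} d"
    using assms d_ge_3 by (auto simp: monomials_def mdeg_add keys_add_nat)
  then have "phi (monof (Suc d) (unit_exp i + uexp d p q)) =
      of_bool (p = i) / multinomial (Suc d) (unit_exp i + uexp d p q)"
    using lookup_G_gexp_shape[OF assms(1), of _ p] unfolding q
    by (simp add: phi_monof add.assoc)
  then show ?thesis
    unfolding gexp_def q by (cases "p = i") (simp_all add: add.assoc)
qed

text \<open>The basis of \<open>S\<^sub>2\<close> modulo \<open>I\<close> consists of \<open>\<alpha>\<^sub>k \<beta>'\<close> (\<open>k < d - 1\<close>) and of
  \<open>\<beta>\<^sup>2, \<beta>\<beta>', \<beta>'\<^sup>2\<close>, which makes \<open>d + 2\<close> elements.\<close>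

lemma apolar_quadric_in_I:
  assumes q: "hf (Suc d) 2 q"
    "\<And>m. m \<in> monomials {..Suc d} (d - 2) \<Longrightarrow> phi (q * monof (Suc d) m) = 0"
  shows "q \<in> I 2"
proof -
  define E where "E = case_sum (\<lambda>k. unit_exp k + unit_exp (Suc d)) (\<lambda>a. uexp d (2 - a) a)"
  \<comment> \<open>Dual family: \<open>E\<close> and \<open>D\<close> of the same index add up to
    \<open>gexp d k\<close> on the left and to \<open>gexp d (2 - a)\<close> on the right. The
    exponent \<open>d - 3\<close> is where \<open>d \<ge> 3\<close> enters.\<close>
  define D where "D = case_sum (\<lambda>k. uexp d k (d - 2 - k)) (\<lambda>a. unit_exp (2 - a) + Poly_Mapping.single (Suc d) (d - 3))"
  define Y :: "(nat + nat) set" where "Y = {..<d - 1} <+> {..2}"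
  show ?thesis
  proof (rule apolar_imp_in_I[of 2 "d - 2" Y E D])
    show "r \<le> card Y"
      using r_le d_ge_3 by (simp add: Y_def card_Plus)
    show "E y \<in> monomials {..Suc d} 2" if "y \<in> Y" for y
      using that d_ge_3 by (auto simp: Y_def E_def monomials_def mdeg_add keys_add_nat split: if_splits)
    show D: "D y \<in> monomials {..Suc d} (d - 2)" if "y \<in> Y" for y
      using that d_ge_3 by (auto simp: Y_def D_def monomials_def mdeg_add keys_add_nat split: if_splits)
    have *: "Poly_Mapping.lookup (G d) (E x + D y) = of_bool (x = y)" if xy: "x \<in> Y" "y \<in> Y" for x y
    proof -
      consider (LL) k l where "k < d - 1" "l < d - 1" "x = Inl k" "y = Inl l"
        | (RR) a b where "a \<le> 2" "b \<le> 2" "x = Inr a" "y = Inr b"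
        | (LR) k b where "k < d - 1" "b \<le> 2" "x = Inl k" "y = Inr b"
        | (RL) a l where "a \<le> 2" "l < d - 1" "x = Inr a" "y = Inl l"
        using xy by (auto simp: Y_def)
      then show ?thesis
      proof cases
        case LL
        have "E x + D y = unit_exp k + Poly_Mapping.single d l + Poly_Mapping.single (Suc d) (d - 1 - l)"
          using LL d_ge_3 by (intro poly_mapping_eqI)
            (auto simp: E_def D_def lookup_add lookup_single when_def)
        from lookup_G_gexp_shape[OF _ this] show ?thesis using LL by auto
      next
        case RR
        have "E x + D y = unit_exp (2 - b) + Poly_Mapping.single d (2 - a) + Poly_Mapping.single (Suc d) (d - 1 - (2 - a))"
          using RR d_ge_3 by (intro poly_mapping_eqI)
            (auto simp: E_def D_def lookup_add lookup_single when_def)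
        from lookup_G_gexp_shape[OF _ this] show ?thesis using RR d_ge_3 by auto
      next
        case LR
        then have "vdeg d (E x + D y) = 2"
          using d_ge_3 by (auto simp: E_def D_def vdeg_add vdeg_single)
        then show ?thesis using lookup_G_eq_0 LR by auto
      next
        case RL
        then have "vdeg d (E x + D y) = 0"
          using d_ge_3 by (auto simp: E_def D_def vdeg_add vdeg_single)
        then show ?thesis using lookup_G_eq_0 RL by auto
      qed
    qed
    show "Poly_Mapping.lookup (G d) (E y + D y) \<noteq> 0" if "y \<in> Y" for y
      using *[OF that that] by simp
    show "Poly_Mapping.lookup (G d) (E x + D y) = 0" if "x \<in> Y" "y \<in> Y" "x \<noteq> y" for x y
      using *[OF that(1,2)] that(3) by simp
    show "phi (q * monof (Suc d) (D y)) = 0" if "y \<in> Y" for y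
      using q(2) D[OF that] by blast
  qed (use d_ge_3 q(1) in \<open>auto simp: Y_def\<close>)
qed

text \<open>\<open>G d\<close> is linear in the \<open>v_i\<close> and \<open>m2\<close> already
  contains one, so only multipliers in \<open>\<beta>\<close>, \<open>\<beta>'\<close> need
  testing.\<close>

lemma monof_in_I:
  assumes "m2 \<in> monomials {..Suc d} 2"
    and "\<And>p. p \<le> d - 2 \<Longrightarrow> phi (monof (Suc d) (m2 + uexp d p (d - 2 - p))) = 0"
    and "vdeg d m2 \<noteq> 0"
  shows "monof (Suc d) m2 \<in> I 2"
proof (rule apolar_quadric_in_I)
  show "hf (Suc d) 2 (monof (Suc d) m2)" using assms(1) by (rule hf_monof)
  fix m assume m: "m \<in> monomials {..Suc d} (d - 2)"
  show "phi (monof (Suc d) m2 * monof (Suc d) m) = 0"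
  proof (cases "vdeg d m = 0")
    case True
    then show ?thesis using vdeg_0_cases[OF m] assms(2) by (metis monof_add)
  next
    case False
    have "2 + (d - 2) = d" using d_ge_3 by simp
    then have "m2 + m \<in> monomials {..Suc d} d"
      using monomials_add[OF assms(1) m] by simp
    moreover have "vdeg d (m2 + m) \<noteq> 1" using False assms(3) unfolding vdeg_add by linarith
    ultimately have "phi (monof (Suc d) (m2 + m)) = 0" by (rule phi_vdeg)
    then show ?thesis by (simp only: monof_add)
  qed
qed

lemma quadric_in_monomials: "x \<le> Suc d \<Longrightarrow> y \<le> Suc d \<Longrightarrow> unit_exp x + unit_exp y \<in> monomials {..Suc d} 2"
  by (auto simp: monomials_def mdeg_add keys_add_nat)

section \<open>Quadrics apolar to the form\<close>

lemma alpha_alpha_in_I: "i < d \<Longrightarrow> j < d \<Longrightarrow> \<alpha> i * \<alpha> j \<in> I 2"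
  unfolding monof_add[symmetric]
proof (rule monof_in_I)
  fix p assume ij: "i < d" "j < d" and p: "p \<le> d - 2"
  show "phi (monof (Suc d) (unit_exp i + unit_exp j + uexp d p (d - 2 - p))) = 0"
  proof (rule phi_vdeg)
    show "unit_exp i + unit_exp j + uexp d p (d - 2 - p) \<in> monomials {..Suc d} d"
      using ij p d_ge_3 by (auto simp: monomials_def mdeg_add keys_add_nat)
    show "vdeg d (unit_exp i + unit_exp j + uexp d p (d - 2 - p)) \<noteq> 1"
      using ij by (simp add: vdeg_add vdeg_single)
  qed
qed (auto simp: vdeg_add vdeg_single intro: quadric_in_monomials[simplified])

text \<open>The only term of \<open>G d\<close> with \<open>v_0\<close> is
  \<open>v_0 u_1^(d-1)\<close>, which contains no \<open>u_0\<close>.\<close>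

lemma alpha_0_beta_in_I: "\<alpha> 0 * \<beta> \<in> I 2"
  unfolding monof_add[symmetric]
proof (rule monof_in_I)
  fix p assume p: "p \<le> d - 2"
  have "unit_exp 0 + unit_exp d + uexp d p (d - 2 - p) = unit_exp 0 + uexp d (Suc p) (d - 2 - p)"
    by (rule poly_mapping_eqI) (auto simp: lookup_add lookup_single when_def)
  then show "phi (monof (Suc d) (unit_exp 0 + unit_exp d + uexp d p (d - 2 - p))) = 0"
    using phi_shape[of 0 "Suc p" "d - 2 - p"] p d_ge_3 by simp
qed (use d_ge_3 in \<open>auto simp: vdeg_add vdeg_single intro: quadric_in_monomials[simplified]\<close>)

text \<open>The term of \<open>G d\<close> with \<open>v_(d-1)\<close> contains no
  \<open>u_1\<close>.\<close>

lemma alpha_last_beta'_in_I: "\<alpha> (d - 1) * \<beta>' \<in> I 2"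
  unfolding monof_add[symmetric]
proof (rule monof_in_I)
  fix p assume p: "p \<le> d - 2"
  have "unit_exp (d - 1) + unit_exp (Suc d) + uexp d p (d - 2 - p) = unit_exp (d - 1) + uexp d p (Suc (d - 2 - p))"
    by (rule poly_mapping_eqI) (auto simp: lookup_add lookup_single when_def)
  then show "phi (monof (Suc d) (unit_exp (d - 1) + unit_exp (Suc d) + uexp d p (d - 2 - p))) = 0"
    using phi_shape[of "d - 1" p "Suc (d - 2 - p)"] p d_ge_3 by simp
qed (use d_ge_3 in \<open>auto simp: vdeg_add vdeg_single intro: quadric_in_monomials[simplified]\<close>)

text \<open>Among the monomials in \<open>\<beta>\<close>, \<open>\<beta>'\<close>, both products
  pair nontrivially with \<open>\<beta> ^ i * \<beta>' ^ (d - 2 - i)\<close> only, so a suitable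
  difference is apolar to \<open>G d\<close>.\<close>

lemma shift_in_I:
  assumes i: "Suc i < d"
  obtains c where "\<alpha> i * \<beta>' - cst c * (\<alpha> (Suc i) * \<beta>) \<in> I 2"
proof -
  let ?g = "\<lambda>i. multinomial (Suc d) (gexp d i)"
  \<comment> \<open>The two pairings are \<open>1 / ?g i\<close> and \<open>1 / ?g (Suc i)\<close>;
    this ratio makes them cancel.\<close>
  let ?c = "?g (Suc i) / ?g i"
  let ?m1 = "unit_exp i + unit_exp (Suc d)" and ?m2 = "unit_exp (Suc i) + unit_exp d"
  have m: "?m1 \<in> monomials {..Suc d} 2" "?m2 \<in> monomials {..Suc d} 2"
    using i by (simp_all add: quadric_in_monomials del: One_nat_def)
  let ?q = "monof (Suc d) ?m1 + cst (- ?c) * monof (Suc d) ?m2"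
  have "?q \<in> I 2"
  proof (rule apolar_quadric_in_I)
    show "hf (Suc d) 2 ?q"
      by (rule hf.add[OF hf_monof[OF m(1)] hf_cst_mult[OF hf_monof[OF m(2)]]])
    fix m assume mm: "m \<in> monomials {..Suc d} (d - 2)"
    have "2 + (d - 2) = d" using d_ge_3 by simp
    then have md: "?m1 + m \<in> monomials {..Suc d} d" "?m2 + m \<in> monomials {..Suc d} d"
      using monomials_add[OF m(1) mm] monomials_add[OF m(2) mm] by auto
    have "?q * monof (Suc d) m = monof (Suc d) (?m1 + m) + cst (- ?c) * monof (Suc d) (?m2 + m)"
      by (simp only: distrib_right mult.assoc monof_add)
    then have *: "phi (?q * monof (Suc d) m) =
        phi (monof (Suc d) (?m1 + m)) - ?c * phi (monof (Suc d) (?m2 + m))"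
      using hf_monof[OF md(1)] hf_monof[OF md(2)] by (simp add: phi_add phi_cst_mult hf_cst_mult)
    show "phi (?q * monof (Suc d) m) = 0"
    proof (cases "vdeg d m = 0")
      case False
      then have "vdeg d (?m1 + m) \<noteq> 1" "vdeg d (?m2 + m) \<noteq> 1"
        using i by (auto simp: vdeg_add vdeg_single)
      then show ?thesis using * md phi_vdeg by simp
    next
      case True
      then obtain p where p: "p \<le> d - 2" "m = uexp d p (d - 2 - p)"
        using vdeg_0_cases[OF mm] by blast
      have "?m1 + m = unit_exp i + uexp d p (Suc (d - 2 - p))" "?m2 + m = unit_exp (Suc i) + uexp d (Suc p) (d - 2 - p)"
        unfolding p(2) by (rule poly_mapping_eqI; auto simp: lookup_add lookup_single when_def)+
      moreover have "p + Suc (d - 2 - p) = d - 1" "Suc p + (d - 2 - p) = d - 1"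
        using p(1) d_ge_3 by auto
      ultimately show ?thesis
        using * i phi_shape[of i p "Suc (d - 2 - p)"] phi_shape[of "Suc i" "Suc p" "d - 2 - p"]
        by simp
    qed
  qed
  then show ?thesis
    using that[of ?c] by (simp add: cst_minus monof_add)
qed

lemma hf_beta'_power: "hf (Suc d) k (\<beta>' ^ k)"
  using hf_power[OF hf_coord[of "Suc d" "Suc d"], of k] by simp

text \<open>Descending induction: modulo \<open>I\<close>, \<open>shift_in_I\<close> trades
  \<open>\<alpha> i * \<beta>'\<close> for a multiple of \<open>\<alpha> (Suc i) * \<beta>\<close>,
  until \<open>\<alpha> (d - 1) * \<beta>'\<close> is reached.\<close>

lemma alpha_beta'_power_in_I: "i \<le> d - 1 \<Longrightarrow> \<alpha> i * \<beta>' ^ (d - i) \<in> I (Suc (d - i))"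
proof (induction rule: inc_induct)
  case base
  then show ?case using alpha_last_beta'_in_I d_ge_3 by (simp add: numeral_2_eq_2)
next
  case (step i)
  define k where "k = d - Suc i"
  have k: "d - i = Suc k" using step(2) by (simp add: k_def)
  have "Suc i < d" using step(2) by simp
  then obtain c where c: "\<alpha> i * \<beta>' - cst c * (\<alpha> (Suc i) * \<beta>) \<in> I 2"
    by (rule shift_in_I)
  have "\<beta>' ^ k * (\<alpha> i * \<beta>' - cst c * (\<alpha> (Suc i) * \<beta>)) \<in> I (k + 2)"
    by (rule mult_in[OF c hf_beta'_power])
  moreover have "cst c * (\<beta> * (\<alpha> (Suc i) * \<beta>' ^ k)) \<in> I (k + 2)"
    using cst_mult_in[OF coord_mult_in[OF _ step(3)], of d c] by (simp add: k_def)
  ultimately have "\<beta>' ^ k * (\<alpha> i * \<beta>' - cst c * (\<alpha> (Suc i) * \<beta>)) +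
      cst c * (\<beta> * (\<alpha> (Suc i) * \<beta>' ^ k)) \<in> I (k + 2)"
    by (rule add_in)
  also have "\<beta>' ^ k * (\<alpha> i * \<beta>' - cst c * (\<alpha> (Suc i) * \<beta>)) +
      cst c * (\<beta> * (\<alpha> (Suc i) * \<beta>' ^ k)) = \<alpha> i * \<beta>' ^ Suc k"
    by (simp add: algebra_simps)
  finally show ?case by (simp add: k)
qed

text \<open>Saturation strips off the factors \<open>\<beta>'\<close> one at a time: all other
  coordinates multiply \<open>\<alpha> 0\<close> into \<open>I\<close> by the quadrics
  found.\<close>

lemma alpha_0_in_I: "\<alpha> 0 \<in> I 1"
proof -
  have "\<alpha> 0 * \<beta>' ^ k \<in> I (Suc k)" if "k \<le> d" for k
    using that
  proof (induction rule: inc_induct)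
    case base
    then show ?case using alpha_beta'_power_in_I[of 0] by simp
  next
    case (step k)
    show ?case
    proof (rule saturated)
      fix i assume "i \<le> Suc d"
      then consider "i < d" | "i = d" | "i = Suc d" by linarith
      then show "\<alpha> i * (\<alpha> 0 * \<beta>' ^ k) \<in> I (Suc (Suc k))"
      proof cases
        case 1
        then show ?thesis
          using mult_in[OF alpha_alpha_in_I[of i 0] hf_beta'_power[of k]] d_ge_3
          by (simp add: algebra_simps)
      next
        case 2
        then show ?thesis
          using mult_in[OF alpha_0_beta_in_I hf_beta'_power[of k]] by (simp add: algebra_simps)
      next
        case 3
        then show ?thesis using step(3) by (simp add: algebra_simps)
      qed
    qed
  qed
  from this[of 0] show ?thesis by simp
qed

text \<open>\<open>\<alpha> 0\<close> in \<open>I\<close> would make the coefficient of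
  \<open>v_0 u_1^(d-1)\<close> in \<open>G d\<close> vanish.\<close>

theorem short_scheme_contradiction: False
proof -
  have pw: "monof (Suc d) (Poly_Mapping.single (Suc d) (d - 1)) = \<beta>' ^ (d - 1)"
    by (simp add: monof_single fun_eq_iff power_fun_apply)
  have "\<beta>' ^ (d - 1) * \<alpha> 0 \<in> I d"
    using mult_in[OF alpha_0_in_I hf_beta'_power[of "d - 1"]] d_ge_3 by simp
  also have "\<beta>' ^ (d - 1) * \<alpha> 0 = monof (Suc d) (unit_exp 0 + uexp d 0 (d - 1))"
    by (simp add: monof_add pw[simplified] mult.commute)
  finally have "phi (monof (Suc d) (unit_exp 0 + uexp d 0 (d - 1))) = 0"
    using d_ge_3 by (intro phi_I hf_monof) (auto simp: monomials_def mdeg_add keys_add_nat)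
  then show False
    using phi_shape[of 0 0 "d - 1"] d_ge_3 by simp
qed

end


section \<open>The border rank\<close>

lemma root_unity_power: "N > 0 \<Longrightarrow> cis (2 * pi / real N) ^ N = 1"
  by (simp add: Complex.DeMoivre)

lemma sum_roots_unity:
  fixes k :: nat
  assumes "\<not> N dvd k" "N > 0"
  shows "(\<Sum>j<N. cis (2 * pi / N) ^ (j * k)) = 0"
proof -
  let ?z = "cis (2 * pi / N) ^ k"
  note N = root_unity_power[OF assms(2)]
  have "?z \<noteq> 1"
  proof
    assume z: "?z = 1"
    have "cis (2 * pi / N) ^ k = cis (2 * pi / N) ^ (N * (k div N) + k mod N)"
      by simp
    also have "\<dots> = cis (2 * pi / N) ^ (k mod N)"
      by (simp only: power_add power_mult N) simp
    also have "\<dots> = cis (2 * pi * real (k mod N) / N)"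
      by (simp add: Complex.DeMoivre algebra_simps)
    finally have "cis (2 * pi * real (k mod N) / N) = cis (2 * pi * real 0 / N)"
      using z by simp
    then have "k mod N = 0"
      using inj_onD[OF bij_betw_imp_inj_on[OF bij_betw_roots_unity[OF assms(2)]], of "k mod N" 0] assms(2)
      by simp
    then show False using assms(1) by auto
  qed
  moreover have "?z ^ N = 1"
    using N by (metis power_commuting_commutes power_mult power_one mult.commute)
  moreover have "(\<Sum>j<N. cis (2 * pi / N) ^ (j * k)) = (\<Sum>j<N. ?z ^ j)"
    by (simp add: mult.commute flip: power_mult)
  ultimately show ?thesis by (simp add: geometric_sum)
qed

lemma tendsto_ev:
  assumes "\<And>x. ((\<lambda>t. Poly_Mapping.lookup (p t) x) \<longlongrightarrow> Poly_Mapping.lookup q x) F"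
  shows "((\<lambda>t. ev (p t) f) \<longlongrightarrow> (ev q f :: complex)) F"
  unfolding ev_def by (intro tendsto_intros assms)

locale border_approximation =
  fixes d :: nat
  assumes d_pos: "d > 0"
begin

definition \<omega> :: complex where
  "\<omega> = cis (2 * pi / real (d + 2))"

lemma \<omega>_power: "\<omega> ^ (d + 2) = 1"
  unfolding \<omega>_def by (rule root_unity_power) simp

lemma sum_\<omega>: "\<not> (d + 2) dvd k \<Longrightarrow> (\<Sum>j<d + 2. \<omega> ^ (j * k)) = 0"
  unfolding \<omega>_def by (rule sum_roots_unity) auto

text \<open>Coefficient of \<open>v_i\<close> in the direction \<open>w_j\<close>, by discrete
  Fourier inversion: against \<open>\<omega> ^ (j * Suc p)\<close> the sum over \<open>j\<close>
  survives only for \<open>p = i\<close>. The denominator normalizes the resulting coefficient to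
  1.\<close>

definition wt :: "nat \<Rightarrow> nat \<Rightarrow> complex" where
  "wt j i = \<omega> ^ (j * (d + 1 - i)) / (of_nat (d + 2) * multinomial (Suc d) (gexp d i))"

text \<open>
  The \<open>d + 2\<close> forms \<open>\<omega>\<^sup>j u\<^sub>0 + u\<^sub>1\<close> are moved in directions spanned by the \<open>v\<^sub>i\<close>.  Their \<open>d\<close>-th powers
  are linearly dependent with coefficients \<open>\<omega>\<^sup>j\<close>, and so the constant term of \<open>approx \<epsilon>\<close>, before the
  division by \<open>\<epsilon>\<close>, vanishes.
\<close>

definition pt :: "nat \<Rightarrow> complex \<Rightarrow> nat \<Rightarrow> complex" where
  "pt j \<epsilon> i = (if i < d then \<epsilon> * wt j i else if i = d then \<omega> ^ j else 1)"

definition approx :: "complex \<Rightarrow> (nat, complex) mpoly" where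
  "approx \<epsilon> = (\<Sum>j<d + 2. scale (\<omega> ^ j / \<epsilon>) (lin (Suc d) (pt j \<epsilon>) ^ d))"

lemma monof_pt:
  "monof (Suc d) m (pt j \<epsilon>) =
    \<epsilon> ^ vdeg d m * (\<Prod>i<d. wt j i ^ Poly_Mapping.lookup m i) * \<omega> ^ (j * Poly_Mapping.lookup m d)"
proof -
  have "monof (Suc d) m (pt j \<epsilon>) = (\<Prod>i<d. pt j \<epsilon> i ^ Poly_Mapping.lookup m i) *
      \<omega> ^ (j * Poly_Mapping.lookup m d)"
    by (simp add: monof_def pt_def power_mult flip: lessThan_Suc_atMost)
  also have "(\<Prod>i<d. pt j \<epsilon> i ^ Poly_Mapping.lookup m i) =
      (\<Prod>i<d. \<epsilon> ^ Poly_Mapping.lookup m i * wt j i ^ Poly_Mapping.lookup m i)"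
    by (rule prod.cong) (auto simp: pt_def power_mult_distrib)
  finally show ?thesis
    by (simp add: prod.distrib power_sum)
qed

text \<open>A monomial of \<open>v\<close>-degree \<open>e\<close> carries \<open>\<epsilon>\<close>
  to the power \<open>e - 1\<close>: degree 0 has to cancel, degree 1 gives the limit, higher
  degrees tend to 0.\<close>

lemma lookup_approx:
  assumes "m \<in> monomials {..Suc d} d"
  shows "Poly_Mapping.lookup (approx \<epsilon>) m = multinomial (Suc d) m * (\<epsilon> ^ vdeg d m / \<epsilon>) *
    (\<Sum>j<d + 2. (\<Prod>i<d. wt j i ^ Poly_Mapping.lookup m i) * \<omega> ^ (j * Suc (Poly_Mapping.lookup m d)))"
  using assms
  by (simp add: approx_def lookup_sum lookup_lin_power monof_pt sum_distrib_left power_add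
      algebra_simps del: sum.lessThan_Suc add_2_eq_Suc')

lemma approx_vdeg_0:
  assumes m: "m \<in> monomials {..Suc d} d" "vdeg d m = 0"
  shows "Poly_Mapping.lookup (approx \<epsilon>) m = 0"
proof -
  obtain p where p: "p \<le> d" "m = uexp d p (d - p)"
    using vdeg_0_cases[OF m] by blast
  \<comment> \<open>The exponent \<open>Suc p\<close> lies between 1 and \<open>d + 1\<close>, hence
    is no multiple of \<open>d + 2\<close>.\<close>
  have "(\<Sum>j<d + 2. \<omega> ^ (j * Suc p)) = 0"
    using p(1) by (intro sum_\<omega>) (auto dest: dvd_imp_le)
  moreover have "Poly_Mapping.lookup m d = p"
    by (simp add: p lookup_add lookup_single)
  ultimately show ?thesis
    using m by (simp add: lookup_approx del: sum.lessThan_Suc add_2_eq_Suc')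
qed

lemma approx_vdeg_1:
  assumes m: "m \<in> monomials {..Suc d} d" "vdeg d m = 1" and "\<epsilon> \<noteq> 0"
  shows "Poly_Mapping.lookup (approx \<epsilon>) m = Poly_Mapping.lookup (G d) m"
proof -
  obtain i where i: "i < d" "i \<in> Poly_Mapping.keys m"
  proof -
    have "\<exists>i<d. Poly_Mapping.lookup m i \<noteq> 0"
      using m(2) by (metis lessThan_iff sum.neutral zero_neq_one)
    then show ?thesis using that by (auto simp: in_keys_iff)
  qed
  define m' where "m' = m - unit_exp i"
  have m': "m = unit_exp i + m'"
    using nat_poly_mapping_diff_single[OF i(2)] by (simp add: m'_def)
  have "m' \<in> monomials {..Suc d} (d - 1)" "vdeg d m' = 0"
    using m i(1) unfolding m' by (auto simp: monomials_def mdeg_add keys_add_nat vdeg_add vdeg_single)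
  then obtain p where p: "p \<le> d - 1" "m' = uexp d p (d - 1 - p)"
    by (rule vdeg_0_cases)
  have meq: "m = unit_exp i + Poly_Mapping.single d p + Poly_Mapping.single (Suc d) (d - 1 - p)"
    by (simp add: m' p add.assoc)
  have lk: "Poly_Mapping.lookup m d = p" "Poly_Mapping.lookup m k = of_bool (k = i)" if "k < d" for k
    using i(1) that by (auto simp: meq lookup_add lookup_single when_def)
  have "(\<Prod>k<d. wt j k ^ Poly_Mapping.lookup m k) = (\<Prod>k<d. if k = i then wt j k else 1)" for j
    by (rule prod.cong) (auto simp: lk)
  then have w: "(\<Prod>k<d. wt j k ^ Poly_Mapping.lookup m k) = wt j i" for j
    using i(1) by simp
  let ?c = "of_nat (d + 2) * multinomial (Suc d) (gexp d i)"
  have "(\<Sum>j<d + 2. wt j i * \<omega> ^ (j * Suc p)) = (\<Sum>j<d + 2. \<omega> ^ (j * (d + 2 + p - i))) / ?c"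
  proof -
    have "wt j i * \<omega> ^ (j * Suc p) = \<omega> ^ (j * (d + 2 + p - i)) / ?c" for j
    proof -
      have "d + 2 + p - i = (d + 1 - i) + Suc p" using i(1) by simp
      then show ?thesis by (simp only: wt_def distrib_left power_add times_divide_eq_left)
    qed
    then show ?thesis by (simp only: sum_divide_distrib)
  qed
  also have "(\<Sum>j<d + 2. \<omega> ^ (j * (d + 2 + p - i))) = of_bool (p = i) * of_nat (d + 2)"
  proof (cases "p = i")
    case True
    have "\<omega> ^ (j * (d + 2)) = 1" for j
      by (metis \<omega>_power mult.commute power_mult power_one)
    then show ?thesis using True by (simp del: sum.lessThan_Suc add_2_eq_Suc')
  next
    case False
    have "\<not> (d + 2) dvd (d + 2 + p - i)"
    proof
      assume "(d + 2) dvd (d + 2 + p - i)"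
      then obtain q where q: "d + 2 + p - i = (d + 2) * q" by (elim dvdE)
      \<comment> \<open>The only multiple of \<open>d + 2\<close> in this range is
        \<open>d + 2\<close> itself, which would give \<open>p = i\<close>.\<close>
      have "0 < d + 2 + p - i" "d + 2 + p - i < (d + 2) * 2" using i(1) p(1) by auto
      then have "0 < q" "q < 2" unfolding q by (auto simp only: nat_0_less_mult_iff mult_less_cancel1)
      then have "q = 1" by simp
      then show False using q False i(1) by auto
    qed
    then show ?thesis using False sum_\<omega> by simp
  qed
  finally have "(\<Sum>j<d + 2. wt j i * \<omega> ^ (j * Suc p)) = of_bool (p = i) * of_nat (d + 2) / ?c" .
  then have "Poly_Mapping.lookup (approx \<epsilon>) m = of_bool (p = i) * (multinomial (Suc d) m / multinomial (Suc d) (gexp d i))"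
    using lk(1)[OF i(1)] w assms(3) unfolding lookup_approx[OF m(1)] m(2)
    by (simp add: field_simps del: sum.lessThan_Suc add_2_eq_Suc' of_nat_Suc of_nat_add)
  also have "\<dots> = of_bool (p = i)"
    using meq by (cases "p = i") (auto simp: gexp_def)
  also have "\<dots> = Poly_Mapping.lookup (G d) m"
    using lookup_G_gexp_shape[OF i(1) meq] by simp
  finally show ?thesis .
qed

lemma approx_in_forms: "approx \<epsilon> \<in> forms {..Suc d} d"
  by (auto simp: approx_def forms_iff lookup_sum lookup_lin_power simp del: sum.lessThan_Suc add_2_eq_Suc')

lemma G_in_forms: "G d \<in> forms {..Suc d} d"
  unfolding G_eq by (intro pm.subspace_sum[OF subspace_forms] single_in_forms gexp_in_monomials) auto

lemma approx_tendsto: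
  "((\<lambda>\<epsilon>. Poly_Mapping.lookup (approx \<epsilon>) m) \<longlongrightarrow> Poly_Mapping.lookup (G d) m) (at 0)"
proof -
  consider (no) "m \<notin> monomials {..Suc d} d"
    | (0) "m \<in> monomials {..Suc d} d" "vdeg d m = 0"
    | (1) "m \<in> monomials {..Suc d} d" "vdeg d m = 1"
    | (2) k where "m \<in> monomials {..Suc d} d" "vdeg d m = Suc (Suc k)"
    by (metis One_nat_def not0_implies_Suc)
  then show ?thesis
  proof cases
    case no
    then show ?thesis
      using approx_in_forms G_in_forms by (auto simp: forms_iff)
  next
    case 0
    then show ?thesis by (simp add: approx_vdeg_0 lookup_G_eq_0)
  next
    case 1
    have "eventually (\<lambda>\<epsilon>. Poly_Mapping.lookup (approx \<epsilon>) m = Poly_Mapping.lookup (G d) m) (at 0)"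
      using approx_vdeg_1[OF 1] by (auto simp: eventually_at intro: exI[of _ 1])
    then show ?thesis by (rule tendsto_eventually)
  next
    case 2
    define C where "C = (\<Sum>j<d + 2. (\<Prod>i<d. wt j i ^ Poly_Mapping.lookup m i) *
        \<omega> ^ (j * Suc (Poly_Mapping.lookup m d)))"
    have "eventually (\<lambda>\<epsilon>. multinomial (Suc d) m * \<epsilon> ^ Suc k * C = Poly_Mapping.lookup (approx \<epsilon>) m) (at 0)"
      using lookup_approx[OF 2(1)] 2(2) by (auto simp: C_def eventually_at intro!: exI[of _ 1])
    moreover have "((\<lambda>\<epsilon>. multinomial (Suc d) m * \<epsilon> ^ Suc k * C) \<longlongrightarrow> multinomial (Suc d) m * 0 ^ Suc k * C) (at 0)"
      by (intro tendsto_intros)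
    ultimately have "((\<lambda>\<epsilon>. Poly_Mapping.lookup (approx \<epsilon>) m) \<longlongrightarrow> 0) (at 0)"
      using Lim_transform_eventually by fastforce
    then show ?thesis using 2(2) by (simp add: lookup_G_eq_0)
  qed
qed

lemma lin_pt_in_veronese: "lin (Suc d) (pt j \<epsilon>) ^ d \<in> veronese (Suc d) d"
proof -
  have "lin (Suc d) (pt j \<epsilon>) \<noteq> 0"
  proof
    assume "lin (Suc d) (pt j \<epsilon>) = 0"
    then have "Poly_Mapping.lookup (lin (Suc d) (pt j \<epsilon>) ^ 1) (unit_exp (Suc d)) = 0"
      by simp
    then show False
      by (simp only: lookup_lin_power) (simp add: pt_def monof_single)
  qed
  then show ?thesis
    using lin_in_forms unfolding veronese_def by blast
qed

lemma G_nonzero: "G d \<noteq> 0"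
proof
  assume "G d = 0"
  then have "Poly_Mapping.lookup (G d) (gexp d 0) = 0" by simp
  then show False using d_pos by (auto simp: lookup_G)
qed

theorem G_in_secant_variety: "G d \<in> secant_variety (monomials {..Suc d} d) (veronese (Suc d) d) (d + 2)"
  unfolding secant_variety_def zariski_closure_def mem_Collect_eq
proof (intro conjI allI ballI impI)
  show "G d \<in> proj_space (monomials {..Suc d} d)"
    using G_in_forms G_nonzero by (auto simp: proj_space_def forms_def)
  fix k f
  let ?S = "\<Union>x\<in>{x. \<forall>i<d + 2. x i \<in> veronese (Suc d) d}. pm.span (x ` {..<d + 2}) - {0}"
  assume f: "\<forall>p\<in>?S. ev p f = 0"
  \<comment> \<open>One coefficient with limit 1 keeps \<open>approx \<epsilon>\<close> away from
    the zero vector, which is no point of projective space.\<close>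
  have "((\<lambda>\<epsilon>. Poly_Mapping.lookup (approx \<epsilon>) (gexp d 0)) \<longlongrightarrow> 1) (at 0)"
  proof -
    have "Poly_Mapping.lookup (G d) (gexp d 0) = 1" using d_pos by (auto simp: lookup_G)
    then show ?thesis using approx_tendsto[of "gexp d 0"] by simp
  qed
  then have "eventually (\<lambda>\<epsilon>. Poly_Mapping.lookup (approx \<epsilon>) (gexp d 0) \<noteq> 0) (at 0)"
    by (rule tendsto_imp_eventually_ne) simp
  then have "eventually (\<lambda>\<epsilon>. ev (approx \<epsilon>) f = 0) (at 0)"
  proof eventually_elim
    case (elim \<epsilon>)
    let ?x = "\<lambda>j. lin (Suc d) (pt j \<epsilon>) ^ d"
    have "approx \<epsilon> \<in> pm.span (?x ` {..<d + 2})"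
      unfolding approx_def by (intro pm.span_sum pm.span_scale pm.span_base) auto
    moreover have "approx \<epsilon> \<noteq> 0" using elim by auto
    ultimately have "approx \<epsilon> \<in> ?S"
      using lin_pt_in_veronese by (intro UN_I[of ?x]) auto
    then show ?case using f by blast
  qed
  then have "((\<lambda>\<epsilon>. ev (approx \<epsilon>) f) \<longlongrightarrow> 0) (at 0)"
    by (rule tendsto_eventually)
  moreover have "((\<lambda>\<epsilon>. ev (approx \<epsilon>) f) \<longlongrightarrow> ev (G d) f) (at 0)"
    by (rule tendsto_ev[OF approx_tendsto])
  ultimately show "ev (G d) f = 0"
    using LIM_unique by blast
qed

end

theorem corollary6p2:
  fixes d :: nat
  assumes "d \<ge> 3"
  shows "wild (d + 1) d (G d)"
proof -
  interpret border_approximation d by standard (use assms in simp)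
  have border: "border_rank (Suc d) d (G d) \<le> enat (d + 2)"
    unfolding border_rank_def using G_in_secant_variety by (intro Inf_lower) blast
  have "enat (Suc (d + 2)) \<le> smoothable_rank (Suc d) d (G d)"
    unfolding smoothable_rank_def
  \<comment> \<open>A lower bound for every admissible length; an empty set of lengths has infinite
    infimum and is covered too.\<close>
  proof (rule Inf_greatest)
    fix x
    assume "x \<in> {enat r | r. \<exists>R. zero_dim_scheme (monomials {..Suc d} d) R r \<and>
      contained_in (monomials {..Suc d} d) R (veronese (Suc d) d) \<and>
      smoothable_in (monomials {..Suc d} d) (veronese (Suc d) d) R r \<and>
      G d \<in> linear_span (monomials {..Suc d} d) R}"
    then obtain r R where x: "x = enat r" and R:
      "zero_dim_scheme (monomials {..Suc d} d) R r"
      "contained_in (monomials {..Suc d} d) R (veronese (Suc d) d)"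
      "G d \<in> linear_span (monomials {..Suc d} d) R" by blast
    have "\<not> r \<le> d + 2"
    proof
      assume "r \<le> d + 2"
      then interpret G_scheme d r R
        by unfold_locales (use R assms in auto)
      show False by (rule short_scheme_contradiction)
    qed
    then show "enat (Suc (d + 2)) \<le> x" by (simp add: x)
  qed
  moreover have "enat (d + 2) < enat (Suc (d + 2))" by simp
  ultimately have "border_rank (Suc d) d (G d) < smoothable_rank (Suc d) d (G d)"
    using border by (meson le_less_trans less_le_trans)
  then show ?thesis
    using G_in_forms G_nonzero by (simp add: wild_def)
qed

end
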